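(* Suppose $q\ge 3$ and $G=\{1,a,a^2\}\subset F_q^*$ is a cyclic group of order $3$. Suppose $\mathcal B$ is a system modulo $q$ such that the set $z(a,1)$ is nonempty and consists of numbers with imaginary part $\ge 2+\sqrt3$. Then $\mathcal B$ is a barrier for each of the following two statements about a family $\mathcal F=(F_{q,c})_{c\in F_q^*}$: (1) for all sufficiently large $x$, $F_{q,1}(x)\ge \min(F_{q,a}(x),F_{q,a^2}(x))$; (2) for all sufficiently large $x$, $F_{q,1}(x)\le \max(F_{q,a}(x),F_{q,a^2}(x))$.
   Context: Let $q\ge 3$ be an integer, $F_q^*$ the multiplicative group of reduced residues modulo $q$, $\phi$ Euler's function, $C_q$ the set of non-principal Dirichlet characters modulo $q$, $\pi(x)$ the number of primes $\le x$. For complex $\rho$ with $\Re\rho>0$ and $x\ge 2$ put $$f(\rho)=\frac{x^{\rho}}{\rho\log x}+\frac1\rho\int_2^x\frac{t^\rho}{t\log^2 t}\,dt .$$ A system $\mathcal B$ (modulo $q$) assigns to each $\chi\in C_q$ a sequence $B(\chi)$ (possibly empty, repetitions allowed) of complex numbers with non-negative imaginary part; $n(\rho,\chi)$ is the number of occurrences of $\rho$ in $B(\chi)$ (0 if it does not occur). If $\rho$ is real it is required that $n(\rho,\chi)=n(\rho,\overline\chi)$. Put $R^+(\mathcal B)=\sup\{\Re\rho:\rho\in\mathcal B\}$, $R^-(\mathcal B)=\inf\{\Re\rho:\rho\in\mathcal B\}$. It is always assumed that $\frac12<R^-(\mathcal B)\le R^+(\mathcal B)\le 1$ and $\sum_{\chi\in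 C_q}\sum_{\rho\in B(\chi)} n(\rho,\chi)/|\rho|<\infty$ (sums are over distinct $\rho$). Define $$P_{q,a}(x;\mathcal B)=-\frac{2}{\phi(q)}\Re\Big(\sum_{\chi\in C_q}\overline\chi(a)\sum_{\rho\in B(\chi)}w(\rho)\,n(\rho,\chi) f(\rho)\Big)+\frac{\pi(x)}{\phi(q)},$$ where the inner sum is over distinct $\rho$, $w(\rho)=\frac12$ if $\rho$ is real and $w(\rho)=1$ otherwise. A family $\mathcal F=(F_{q,a})_{a\in F_q^*}$ of functions $[0,\infty)\to\mathbb R$ is $\beta$-similar to $\mathcal P_q=(P_{q,a}(\cdot;\mathcal B))_{a\in F_q^*}$ if $|F_{q,a}(x)-P_{q,a}(x;\mathcal B)|=o(x^\beta/\log x)$ as $x\to\infty$ for every $a$. For a statement $\mathcal I(\mathcal F)$ about such families, $\mathcal B$ is a barrier for $\mathcal I$ if, with $\beta=R^-(\mathcal B)$, for every $\mathcal F$ that is $\beta$-similar to $\mathcal P_q$ the statement $\mathcal I(\mathcal F)$ is false. For $a,b\in F_q^*$ let $g(\rho;a,b)=\sum_{\chi\in C_q}n(\rho,\chi)(\chi(a)-\chi(b))$, $\beta(a,b)=\sup\{\Re\rho: g(\rho;a,b)\ne0\}$, and $z(a,b)=\bigcup_{\chi\in C_q}\{\rho\in B(\chi): g(\rho;a,b)\ne 0,\ \Re\rho=\beta(a,b)\}$. *)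

theory Defs
  imports
    "HOL-Analysis.Analysis"
    "HOL-Library.Landau_Symbols"
    "HOL-Number_Theory.Number_Theory"
    "HOL-Algebra.Elementary_Groups"
begin

definition reduced_residues :: "nat \<Rightarrow> int monoid" where
  "reduced_residues q = units_of (residue_ring (int q))"

definition dirichlet_char :: "nat \<Rightarrow> (int \<Rightarrow> complex) \<Rightarrow> bool" where
  "dirichlet_char q \<psi> \<longleftrightarrow>
     (\<forall>m n. \<psi> (m * n) = \<psi> m * \<psi> n) \<and>
     (\<forall>n. \<psi> (n + int q) = \<psi> n) \<and>
     (\<forall>n. \<psi> n \<noteq> 0 \<longleftrightarrow> coprime n (int q))"

definition principal_char :: "nat \<Rightarrow> int \<Rightarrow> complex" where
  "principal_char q = (\<lambda>n. if coprime n (int q) then 1 else 0)"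

definition nonprincipal_chars :: "nat \<Rightarrow> (int \<Rightarrow> complex) set" where
  "nonprincipal_chars q = {\<psi>. dirichlet_char q \<psi> \<and> \<psi> \<noteq> principal_char q}"

definition conj_char :: "(int \<Rightarrow> complex) \<Rightarrow> int \<Rightarrow> complex" where
  "conj_char \<psi> = (\<lambda>n. cnj (\<psi> n))"

definition prime_pi :: "real \<Rightarrow> nat" where
  "prime_pi x = card {p::nat. prime p \<and> real p \<le> x}"

definition f_zero :: "real \<Rightarrow> complex \<Rightarrow> complex" where
  "f_zero x \<rho> =
     of_real x powr \<rho> / (\<rho> * of_real (ln x)) +
     1 / \<rho> * integral {2..x} (\<lambda>t. of_real t powr \<rho> / of_real (t * (ln t)\<^sup>2))"

(* A finite (possibly empty) or infinite sequence of complex numbers is encoded as a function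
   nat => complex option whose domain is an initial segment of the natural numbers.
   The values of a zero_system outside nonprincipal_chars q are irrelevant. *)
type_synonym zero_system = "(int \<Rightarrow> complex) \<Rightarrow> nat \<Rightarrow> complex option"

definition zeros :: "zero_system \<Rightarrow> (int \<Rightarrow> complex) \<Rightarrow> complex set" where
  "zeros B \<psi> = {\<rho>. \<exists>k. B \<psi> k = Some \<rho>}"

definition occurrences :: "zero_system \<Rightarrow> complex \<Rightarrow> (int \<Rightarrow> complex) \<Rightarrow> nat" where
  "occurrences B \<rho> \<psi> = card {k. B \<psi> k = Some \<rho>}"

definition all_zeros :: "nat \<Rightarrow> zero_system \<Rightarrow> complex set" where
  "all_zeros q B = (\<Union>\<psi>\<in>nonprincipal_chars q. zeros B \<psi>)"

definition R_plus :: "nat \<Rightarrow> zero_system \<Rightarrow> real" where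
  "R_plus q B = Sup (Re ` all_zeros q B)"

definition R_minus :: "nat \<Rightarrow> zero_system \<Rightarrow> real" where
  "R_minus q B = Inf (Re ` all_zeros q B)"

(* Finiteness of each set of occurrences is part of the convergence of the sum of
   n(rho,chi)/|rho|; it is separate because card is 0 on infinite sets.  Likewise nonemptiness
   and boundedness are what 1/2 < R^- <= R^+ <= 1 says for extended-real Inf and Sup; they are
   separate because Inf and Sup are real-valued here. *)
definition is_system :: "nat \<Rightarrow> zero_system \<Rightarrow> bool" where
  "is_system q B \<longleftrightarrow>
     (\<forall>\<psi>\<in>nonprincipal_chars q.
        (\<forall>k. B \<psi> (Suc k) \<noteq> None \<longrightarrow> B \<psi> k \<noteq> None) \<and>
        (\<forall>\<rho>\<in>zeros B \<psi>. Im \<rho> \<ge> 0) \<and>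
        (\<forall>\<rho>. \<rho> \<in> \<real> \<longrightarrow> occurrences B \<rho> \<psi> = occurrences B \<rho> (conj_char \<psi>)) \<and>
        (\<forall>\<rho>. finite {k. B \<psi> k = Some \<rho>}) \<and>
        (\<lambda>\<rho>. real (occurrences B \<rho> \<psi>) / norm \<rho>) summable_on zeros B \<psi>) \<and>
     all_zeros q B \<noteq> {} \<and> bdd_below (Re ` all_zeros q B) \<and> bdd_above (Re ` all_zeros q B) \<and>
     1 / 2 < R_minus q B \<and> R_minus q B \<le> R_plus q B \<and> R_plus q B \<le> 1"

definition weight :: "complex \<Rightarrow> real" where
  "weight \<rho> = (if \<rho> \<in> \<real> then 1 / 2 else 1)"

definition P_sys :: "nat \<Rightarrow> zero_system \<Rightarrow> int \<Rightarrow> real \<Rightarrow> real" where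
  "P_sys q B a x =
     - (2 / real (totient q)) *
       Re (\<Sum>\<psi>\<in>nonprincipal_chars q. conj_char \<psi> a *
             (\<Sum>\<^sub>\<infinity>\<rho>\<in>zeros B \<psi>. of_real (weight \<rho>) * of_nat (occurrences B \<rho> \<psi>) * f_zero x \<rho>))
     + real (prime_pi x) / real (totient q)"

(* Families (F_{q,a}) are functions int => real => real; only the indices in
   reduced_residues q and large arguments matter. *)
definition beta_similar ::
    "nat \<Rightarrow> real \<Rightarrow> (int \<Rightarrow> real \<Rightarrow> real) \<Rightarrow> (int \<Rightarrow> real \<Rightarrow> real) \<Rightarrow> bool" where
  "beta_similar q \<beta> F P \<longleftrightarrow>
     (\<forall>a\<in>carrier (reduced_residues q).
        (\<lambda>x. \<bar>F a x - P a x\<bar>) \<in> o[at_top](\<lambda>x. x powr \<beta> / ln x))"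

definition barrier ::
    "nat \<Rightarrow> zero_system \<Rightarrow> ((int \<Rightarrow> real \<Rightarrow> real) \<Rightarrow> bool) \<Rightarrow> bool" where
  "barrier q B I \<longleftrightarrow> (\<forall>F. beta_similar q (R_minus q B) F (P_sys q B) \<longrightarrow> \<not> I F)"

definition g_sys :: "nat \<Rightarrow> zero_system \<Rightarrow> complex \<Rightarrow> int \<Rightarrow> int \<Rightarrow> complex" where
  "g_sys q B \<rho> a b = (\<Sum>\<psi>\<in>nonprincipal_chars q. of_nat (occurrences B \<rho> \<psi>) * (\<psi> a - \<psi> b))"

definition beta_sys :: "nat \<Rightarrow> zero_system \<Rightarrow> int \<Rightarrow> int \<Rightarrow> real" where
  "beta_sys q B a b = Sup (Re ` {\<rho>. g_sys q B \<rho> a b \<noteq> 0})"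

definition z_sys :: "nat \<Rightarrow> zero_system \<Rightarrow> int \<Rightarrow> int \<Rightarrow> complex set" where
  "z_sys q B a b =
     (\<Union>\<psi>\<in>nonprincipal_chars q.
        {\<rho> \<in> zeros B \<psi>. g_sys q B \<rho> a b \<noteq> 0 \<and> Re \<rho> = beta_sys q B a b})"

end

theory Submission
  imports Defs "HOL-Real_Asymp.Real_Asymp"
begin

text \<open>For every character \<open>\<psi>\<close>, the value \<open>w = \<psi>(a)\<close> is a cube root of unity.  The difference
\<open>P_{a^2} - P_1\<close> involves the numbers \<open>w - 1\<close> and \<open>P_a - P_1\<close> their conjugates, so characters with
\<open>w = 1\<close> drop out.  Every zero of any other character has \<open>g(\<rho>; a, 1) \<noteq> 0\<close>, because all numbers
\<open>w - 1\<close> lie in the sector \<open>\<bar>Im\<bar> \<le> - Re / sqrt 3\<close>, where sums cannot cancel.  Hence no zero to the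
right of the line \<open>Re \<rho> = \<beta>(a,1)\<close> contributes, and the main terms come from \<open>z(a,1)\<close>: up to
\<open>o(x^\<beta> / log x)\<close> and a positive factor, the differences \<open>P_a - P_1\<close> and \<open>P_{a^2} - P_1\<close> at \<open>x = e^u\<close>
are \<open>- h1(u)\<close> and \<open>- h2(u)\<close>, where \<open>h2(u)\<close> is the real part of the sum of
\<open>g(\<rho>) / \<rho> * e^{i \<gamma> u}\<close> over \<open>\<rho> = \<beta> + i \<gamma>\<close> in \<open>z(a,1)\<close>, and \<open>h1\<close> is the same with the conjugate of
\<open>g(\<rho>)\<close>.

It therefore suffices that \<open>h1\<close> and \<open>h2\<close> are simultaneously positive, and simultaneously negative,
for arbitrarily large \<open>u\<close>, with a fixed margin.  Expanding \<open>g(\<rho>) / \<rho>\<close> gives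
\<open>h2 = - A - D + E - F\<close> and \<open>h1 = - A - D - E + F\<close>, where \<open>A, F\<close> are sine sums and \<open>D, E\<close> are cosine
sums.  Suppose that \<open>\<bar>A\<bar> > \<bar>D\<bar> + \<bar>E\<bar> + \<bar>F\<bar>\<close> at some \<open>u\<close>.  Then \<open>h1\<close> and \<open>h2\<close> have the same sign at
\<open>u\<close>, and the opposite common sign at \<open>- u\<close>, since \<open>A\<close> and \<open>F\<close> are odd and \<open>D\<close> and \<open>E\<close> are even;
almost periods move both points to arbitrarily large arguments (lemma \<open>race_sums_same_sign\<close>).

Such a \<open>u\<close> is found in mean square (lemma \<open>main_sine_dominates\<close>).  The amplitudes in \<open>D\<close>, \<open>E\<close> and
\<open>F\<close> are at most \<open>t\<close>, \<open>s\<close> and \<open>t s\<close> times those in \<open>A\<close>, where \<open>s = 1 / sqrt 3\<close> is the slope of the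
sector and \<open>t = 1 / (2 + sqrt 3)\<close> bounds \<open>\<beta> / \<gamma>\<close> by the hypothesis on imaginary parts.  These are the
tangents of \<open>\<pi>/6\<close> and \<open>\<pi>/12\<close>, and the addition formula at \<open>\<pi>/4\<close> gives \<open>t + s + t s = 1\<close>: the
constant \<open>2 + sqrt 3\<close> is just large enough for the Cauchy-Schwarz inequality with these weights.  The
mean square inequality is strict as soon as some \<open>\<rho>\<close> has \<open>\<beta> / \<gamma> < t\<close>; otherwise \<open>z(a,1)\<close> is the single
point \<open>1 + i (2 + sqrt 3)\<close>, and \<open>u = \<pi> / (2 \<gamma>)\<close> works.\<close>

section \<open>Mean values of trigonometric sums\<close>

text \<open>Asking for a bounded antiderivative of \<open>f - m\<close> makes \<open>m\<close> the mean value of \<open>f\<close> over long intervals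
without integrals: sums of cosines have explicit antiderivatives, and the mean value theorem is all
that is needed to use the notion.\<close>

definition has_mean :: "(real \<Rightarrow> real) \<Rightarrow> real \<Rightarrow> bool" where
  "has_mean f m \<longleftrightarrow>
     (\<exists>G. (\<forall>u. (G has_real_derivative f u - m) (at u)) \<and> (\<exists>C. \<forall>u. \<bar>G u\<bar> \<le> C))"

lemma has_mean_cmult:
  assumes "has_mean f m"
  shows "has_mean (\<lambda>u. c * f u) (c * m)"
proof -
  obtain G C where G: "\<And>u. (G has_real_derivative f u - m) (at u)" "\<And>u. \<bar>G u\<bar> \<le> C"
    using assms unfolding has_mean_def by blast
  have "((\<lambda>u. c * G u) has_real_derivative c * f u - c * m) (at u)" for u
    using DERIV_cmult[OF G(1), of c u] by (simp add: algebra_simps)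
  moreover have "\<bar>c * G u\<bar> \<le> \<bar>c\<bar> * C" for u
    using G(2)[of u] by (simp add: abs_mult mult_left_mono)
  ultimately show ?thesis unfolding has_mean_def by blast
qed

lemma has_mean_add:
  assumes "has_mean f m" "has_mean g n"
  shows "has_mean (\<lambda>u. f u + g u) (m + n)"
proof -
  obtain G C where G: "\<And>u. (G has_real_derivative f u - m) (at u)" "\<And>u. \<bar>G u\<bar> \<le> C"
    using assms unfolding has_mean_def by blast
  obtain H D where H: "\<And>u. (H has_real_derivative g u - n) (at u)" "\<And>u. \<bar>H u\<bar> \<le> D"
    using assms unfolding has_mean_def by blast
  have "((\<lambda>u. G u + H u) has_real_derivative (f u + g u) - (m + n)) (at u)" for u
    using DERIV_add[OF G(1) H(1), of u] by (simp add: algebra_simps)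
  moreover have "\<bar>G u + H u\<bar> \<le> C + D" for u
    using G(2)[of u] H(2)[of u] by linarith
  ultimately show ?thesis unfolding has_mean_def by blast
qed

lemma has_mean_diff:
  assumes "has_mean f m" "has_mean g n"
  shows "has_mean (\<lambda>u. f u - g u) (m - n)"
  using has_mean_add[OF assms(1) has_mean_cmult[OF assms(2), of "-1"]] by simp

lemma has_mean_const: "has_mean (\<lambda>u. c) c"
  unfolding has_mean_def by (rule exI[of _ "\<lambda>u. 0"]) auto

lemma has_mean_sum:
  assumes "finite I" "\<And>i. i \<in> I \<Longrightarrow> has_mean (f i) (m i)"
  shows "has_mean (\<lambda>u. \<Sum>i\<in>I. f i u) (\<Sum>i\<in>I. m i)"
  using assms
proof (induction I rule: finite_induct)
  case empty
  show ?case using has_mean_const[of 0] by simp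
next
  case (insert i I)
  then show ?case by (simp add: has_mean_add)
qed

lemma has_mean_cos: "has_mean (\<lambda>u. cos (\<kappa> * u)) (if \<kappa> = 0 then 1 else 0)"
proof (cases "\<kappa> = 0")
  case True
  then show ?thesis using has_mean_const[of 1] by simp
next
  case False
  have "((\<lambda>u. sin (\<kappa> * u) / \<kappa>) has_real_derivative cos (\<kappa> * u) - 0) (at u)" for u
    using False by (auto intro!: derivative_eq_intros)
  moreover have "\<bar>sin (\<kappa> * u) / \<kappa>\<bar> \<le> 1 / \<bar>\<kappa>\<bar>" for u
    by (simp add: divide_right_mono)
  ultimately have "has_mean (\<lambda>u. cos (\<kappa> * u)) 0" unfolding has_mean_def by blast
  then show ?thesis using False by simp
qed

text \<open>If \<open>f \<le> c < m\<close> held everywhere, the bounded antiderivative of \<open>f - m\<close> would decrease at least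
linearly.\<close>

lemma has_mean_exceeds:
  assumes "has_mean f m" "c < m"
  obtains u where "f u > c"
proof -
  have "\<exists>u. f u > c"
  proof (rule ccontr)
    assume "\<not> ?thesis"
    then have le: "f u \<le> c" for u by (meson not_le)
    obtain G C where G: "\<And>u. (G has_real_derivative f u - m) (at u)" "\<And>u. \<bar>G u\<bar> \<le> C"
      using assms unfolding has_mean_def by blast
    define T where "T = (2 * C + 1) / (m - c)"
    have "C \<ge> 0" using G(2)[of 0] by linarith
    then have "T \<ge> 0" using assms(2) by (simp add: T_def)
    have "((\<lambda>u. G u - (c - m) * u) has_real_derivative f u - m - (c - m)) (at u)" for u
      by (auto intro!: derivative_eq_intros G(1))
    then have "G T - (c - m) * T \<le> G 0 - (c - m) * 0"
      using le by (intro DERIV_nonpos_imp_nonincreasing[OF \<open>T \<ge> 0\<close>]) force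
    moreover have "(m - c) * T = 2 * C + 1" using assms(2) by (simp add: T_def)
    ultimately show False using G(2)[of T] G(2)[of 0] by (simp add: algebra_simps)
  qed
  then show thesis using that by blast
qed

lemma has_mean_sin_sin:
  assumes "\<gamma> > 0" "\<eta> > 0"
  shows "has_mean (\<lambda>u. sin (\<gamma> * u) * sin (\<eta> * u)) (if \<gamma> = \<eta> then 1 / 2 else 0)"
proof -
  have "(\<lambda>u. sin (\<gamma> * u) * sin (\<eta> * u)) =
        (\<lambda>u. 1 / 2 * cos ((\<gamma> - \<eta>) * u) - 1 / 2 * cos ((\<gamma> + \<eta>) * u))"
    by (simp add: sin_times_sin left_diff_distrib distrib_right diff_divide_distrib)
  then show ?thesis
    using has_mean_diff[OF has_mean_cmult[OF has_mean_cos, of "1/2" "\<gamma> - \<eta>"]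
        has_mean_cmult[OF has_mean_cos, of "1/2" "\<gamma> + \<eta>"]] assms by (auto split: if_splits)
qed

lemma has_mean_cos_cos:
  assumes "\<gamma> > 0" "\<eta> > 0"
  shows "has_mean (\<lambda>u. cos (\<gamma> * u) * cos (\<eta> * u)) (if \<gamma> = \<eta> then 1 / 2 else 0)"
proof -
  have "(\<lambda>u. cos (\<gamma> * u) * cos (\<eta> * u)) =
        (\<lambda>u. 1 / 2 * cos ((\<gamma> - \<eta>) * u) + 1 / 2 * cos ((\<gamma> + \<eta>) * u))"
    by (simp add: cos_times_cos left_diff_distrib distrib_right add_divide_distrib)
  then show ?thesis
    using has_mean_add[OF has_mean_cmult[OF has_mean_cos, of "1/2" "\<gamma> - \<eta>"]
        has_mean_cmult[OF has_mean_cos, of "1/2" "\<gamma> + \<eta>"]] assms by (auto split: if_splits)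
qed

text \<open>Parseval's identity for finite sums; \<open>T\<close> stands for the sine or the cosine.\<close>

lemma has_mean_square:
  fixes \<gamma> c :: "'i \<Rightarrow> real" and T :: "real \<Rightarrow> real"
  assumes "finite I" "inj_on \<gamma> I"
    and orth: "\<And>i j. i \<in> I \<Longrightarrow> j \<in> I \<Longrightarrow>
      has_mean (\<lambda>u. T (\<gamma> i * u) * T (\<gamma> j * u)) (if \<gamma> i = \<gamma> j then 1 / 2 else 0)"
  shows "has_mean (\<lambda>u. (\<Sum>i\<in>I. c i * T (\<gamma> i * u))\<^sup>2) (\<Sum>i\<in>I. (c i)\<^sup>2 / 2)"
proof -
  have "has_mean (\<lambda>u. \<Sum>i\<in>I. \<Sum>j\<in>I. (c i * c j) * (T (\<gamma> i * u) * T (\<gamma> j * u)))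
          (\<Sum>i\<in>I. \<Sum>j\<in>I. (c i * c j) * (if \<gamma> i = \<gamma> j then 1 / 2 else 0))"
    using assms by (intro has_mean_sum has_mean_cmult) auto
  moreover have "(\<Sum>j\<in>I. (c i * c j) * (if \<gamma> i = \<gamma> j then 1 / 2 else 0)) = (c i)\<^sup>2 / 2"
    if "i \<in> I" for i
  proof -
    have "(\<Sum>j\<in>I. (c i * c j) * (if \<gamma> i = \<gamma> j then 1 / 2 else 0)) =
          (\<Sum>j\<in>I. if i = j then (c i)\<^sup>2 / 2 else 0)"
      using that assms(2) by (intro sum.cong) (auto simp: power2_eq_square inj_on_eq_iff)
    then show ?thesis using that assms(1) by simp
  qed
  moreover have "(\<Sum>i\<in>I. \<Sum>j\<in>I. (c i * c j) * (T (\<gamma> i * u) * T (\<gamma> j * u))) =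
      (\<Sum>i\<in>I. c i * T (\<gamma> i * u))\<^sup>2" for u
    by (simp add: power2_eq_square sum_product algebra_simps)
  ultimately show ?thesis by simp
qed

text \<open>Cauchy-Schwarz: the difference of the two sides is
\<open>r s (x/r - y/s)\<^sup>2 + r t (x/r - z/t)\<^sup>2 + s t (y/s - z/t)\<^sup>2\<close>.\<close>

lemma weighted_square_of_sum:
  fixes x y z :: real
  assumes "r > 0" "s > 0" "t > 0" "r + s + t = 1"
  shows "(x + y + z)\<^sup>2 \<le> x\<^sup>2 / r + y\<^sup>2 / s + z\<^sup>2 / t"
proof -
  define X Y W where "X = x / r" and "Y = y / s" and "W = z / t"
  have t: "t = 1 - r - s" using assms(4) by simp
  have xyz: "x = r * X" "y = s * Y" "z = t * W" using assms by (auto simp: X_def Y_def W_def)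
  have "x\<^sup>2 / r + y\<^sup>2 / s + z\<^sup>2 / t = r * X\<^sup>2 + s * Y\<^sup>2 + t * W\<^sup>2"
    using assms by (simp add: xyz power2_eq_square)
  moreover have "r * X\<^sup>2 + s * Y\<^sup>2 + t * W\<^sup>2 - (x + y + z)\<^sup>2 =
     r * s * (X - Y)\<^sup>2 + r * t * (X - W)\<^sup>2 + s * t * (Y - W)\<^sup>2"
    unfolding xyz t by (simp add: power2_eq_square algebra_simps)
  ultimately show ?thesis using assms by (smt (verit) mult_nonneg_nonneg zero_le_power2)
qed

text \<open>The square of the sine sum minus the weighted squares of the three other sums has a mean value above
\<open>c\<close>, so it exceeds \<open>c\<close> somewhere.  The gain \<open>c / (2 * A)\<close> depends on the index set only through
bounds on \<open>c\<close> and \<open>A\<close>, which makes it uniform over all finite sets of zeros later on.\<close>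

lemma sine_sum_dominates:
  fixes \<gamma> p d e f :: "'i \<Rightarrow> real" and I :: "'i set"
  defines "X \<equiv> \<lambda>u. \<bar>\<Sum>i\<in>I. d i * cos (\<gamma> i * u)\<bar> + \<bar>\<Sum>i\<in>I. e i * cos (\<gamma> i * u)\<bar>
                  + \<bar>\<Sum>i\<in>I. f i * sin (\<gamma> i * u)\<bar>"
  assumes "finite I" "inj_on \<gamma> I" and pos: "\<And>i. i \<in> I \<Longrightarrow> \<gamma> i > 0"
    and rst: "r > 0" "s > 0" "t > 0" "r + s + t = 1"
    and gap: "c < (\<Sum>i\<in>I. ((p i)\<^sup>2 - (d i)\<^sup>2 / r - (e i)\<^sup>2 / s - (f i)\<^sup>2 / t) / 2)" and "c > 0"
    and A: "(\<Sum>i\<in>I. \<bar>p i\<bar>) \<le> A"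
  obtains u where "\<bar>\<Sum>i\<in>I. p i * sin (\<gamma> i * u)\<bar> \<ge> X u + c / (2 * A)"
proof -
  have ms: "has_mean (\<lambda>u. (\<Sum>i\<in>I. c i * sin (\<gamma> i * u))\<^sup>2) (\<Sum>i\<in>I. (c i)\<^sup>2 / 2)" for c
    using assms by (intro has_mean_square has_mean_sin_sin) auto
  have mc: "has_mean (\<lambda>u. (\<Sum>i\<in>I. c i * cos (\<gamma> i * u))\<^sup>2) (\<Sum>i\<in>I. (c i)\<^sup>2 / 2)" for c
    using assms by (intro has_mean_square has_mean_cos_cos) auto
  have "has_mean (\<lambda>u. (\<Sum>i\<in>I. p i * sin (\<gamma> i * u))\<^sup>2 - 1 / r * (\<Sum>i\<in>I. d i * cos (\<gamma> i * u))\<^sup>2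
          - 1 / s * (\<Sum>i\<in>I. e i * cos (\<gamma> i * u))\<^sup>2 - 1 / t * (\<Sum>i\<in>I. f i * sin (\<gamma> i * u))\<^sup>2)
        ((\<Sum>i\<in>I. (p i)\<^sup>2 / 2) - 1 / r * (\<Sum>i\<in>I. (d i)\<^sup>2 / 2)
          - 1 / s * (\<Sum>i\<in>I. (e i)\<^sup>2 / 2) - 1 / t * (\<Sum>i\<in>I. (f i)\<^sup>2 / 2))"
    by (intro has_mean_diff has_mean_cmult ms mc)
  moreover have "(\<Sum>i\<in>I. (p i)\<^sup>2 / 2) - 1 / r * (\<Sum>i\<in>I. (d i)\<^sup>2 / 2)
          - 1 / s * (\<Sum>i\<in>I. (e i)\<^sup>2 / 2) - 1 / t * (\<Sum>i\<in>I. (f i)\<^sup>2 / 2) =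
     (\<Sum>i\<in>I. ((p i)\<^sup>2 - (d i)\<^sup>2 / r - (e i)\<^sup>2 / s - (f i)\<^sup>2 / t) / 2)"
    by (simp add: sum_subtractf sum_distrib_left diff_divide_distrib mult.commute)
  ultimately obtain u where u: "c < (\<Sum>i\<in>I. p i * sin (\<gamma> i * u))\<^sup>2
      - 1 / r * (\<Sum>i\<in>I. d i * cos (\<gamma> i * u))\<^sup>2
      - 1 / s * (\<Sum>i\<in>I. e i * cos (\<gamma> i * u))\<^sup>2 - 1 / t * (\<Sum>i\<in>I. f i * sin (\<gamma> i * u))\<^sup>2"
    using has_mean_exceeds gap by (metis (no_types, lifting))
  define S where "S = \<bar>\<Sum>i\<in>I. p i * sin (\<gamma> i * u)\<bar>"
  have X0: "X u \<ge> 0" by (simp add: X_def)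
  have "(X u)\<^sup>2 \<le> (\<Sum>i\<in>I. d i * cos (\<gamma> i * u))\<^sup>2 / r
      + (\<Sum>i\<in>I. e i * cos (\<gamma> i * u))\<^sup>2 / s + (\<Sum>i\<in>I. f i * sin (\<gamma> i * u))\<^sup>2 / t"
    using weighted_square_of_sum[OF rst, of "\<bar>\<Sum>i\<in>I. d i * cos (\<gamma> i * u)\<bar>"
        "\<bar>\<Sum>i\<in>I. e i * cos (\<gamma> i * u)\<bar>" "\<bar>\<Sum>i\<in>I. f i * sin (\<gamma> i * u)\<bar>"]
    unfolding X_def by simp
  with u have "c < S\<^sup>2 - (X u)\<^sup>2" by (simp add: S_def)
  then have prod: "c < (S - X u) * (S + X u)" by (simp add: power2_eq_square algebra_simps)
  have "S \<le> (\<Sum>i\<in>I. \<bar>p i\<bar>)"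
    unfolding S_def
    by (rule order_trans[OF sum_abs], rule sum_mono) (simp add: abs_mult mult_left_le)
  then have "S \<le> A" using A by linarith
  have "S > X u"
    using prod \<open>c > 0\<close> X0 by (smt (verit, best) S_def mult_nonpos_nonneg)
  then have "S + X u \<le> 2 * A" "A > 0" using \<open>S \<le> A\<close> X0 by linarith+
  then have "c < (S - X u) * (2 * A)"
    using prod \<open>S > X u\<close> by (smt (verit) mult_left_mono)
  then have "c / (2 * A) < S - X u" using \<open>A > 0\<close> by (simp add: pos_divide_less_eq)
  then show thesis using that[of u] by (simp add: S_def)
qed

section \<open>Almost periods and race sums\<close>

lemma norm_cis_minus_one_le: "norm (cis x - 1) \<le> \<bar>x\<bar>"
proof -
  have "norm (cis x - 1) = \<bar>2 * sin (x / 2)\<bar>"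
    using dist_exp_i_1[of x] by (simp add: cis_conv_exp mult.commute)
  also have "\<dots> \<le> \<bar>x\<bar>" using abs_sin_x_le_abs_x[of "x / 2"] by (simp add: abs_mult)
  finally show ?thesis .
qed

text \<open>Dirichlet's theorem on simultaneous approximation.  Applying it to the frequencies multiplied by
\<open>K \<ge> T\<close> makes the almost period, a positive integer multiple of \<open>K\<close>, large.\<close>

lemma almost_period:
  fixes \<gamma> :: "'i \<Rightarrow> real"
  assumes "finite I" "\<epsilon> > 0"
  obtains \<tau> where "\<tau> \<ge> T" "\<And>i. i \<in> I \<Longrightarrow> norm (cis (\<gamma> i * \<tau>) - 1) \<le> \<epsilon>"
proof -
  obtain h :: "nat \<Rightarrow> 'i" where h: "bij_betw h {0..<card I} I"
    using ex_bij_betw_nat_finite[OF assms(1)] by blast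
  define K where "K = max T 1"
  obtain N :: nat where N: "2 * pi / \<epsilon> < real N" using reals_Archimedean2 by blast
  have "2 * pi / \<epsilon> > 0" using assms(2) by simp
  with N have N0: "N > 0" by (cases "N = 0") auto
  obtain m p where m: "0 < m"
    and p: "\<And>i. i < card I \<Longrightarrow> \<bar>of_int m * (\<gamma> (h i) * K / (2 * pi)) - of_int (p i)\<bar> < 1 / N"
    using Dirichlet_approx_simult[OF N0, of "card I" "\<lambda>i. \<gamma> (h i) * K / (2 * pi)"] by metis
  define \<tau> where "\<tau> = of_int m * K"
  have "\<tau> \<ge> 1 * K" unfolding \<tau>_def using m by (intro mult_right_mono) (auto simp: K_def)
  then have "\<tau> \<ge> T" by (simp add: K_def)
  moreover have "norm (cis (\<gamma> i * \<tau>) - 1) \<le> \<epsilon>" if "i \<in> I" for i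
  proof -
    obtain j where j: "j < card I" "h j = i"
      using h \<open>i \<in> I\<close> unfolding bij_betw_def by force
    define y where "y = of_int m * (\<gamma> i * K / (2 * pi)) - of_int (p j)"
    have "\<gamma> i * \<tau> = 2 * pi * y + 2 * pi * of_int (p j)"
      by (simp add: y_def \<tau>_def field_simps)
    then have "cis (\<gamma> i * \<tau>) = cis (2 * pi * y) * cis (2 * pi * of_int (p j))"
      by (simp only: cis_mult)
    also have "cis (2 * pi * of_int (p j)) = 1" by (simp add: cis_multiple_2pi)
    finally have "norm (cis (\<gamma> i * \<tau>) - 1) \<le> 2 * pi * \<bar>y\<bar>"
      using norm_cis_minus_one_le[of "2 * pi * y"] by (simp add: abs_mult)
    also have "\<dots> \<le> 2 * pi * (1 / N)"
      using p[OF j(1)] j(2) by (intro mult_left_mono) (auto simp: y_def)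
    also have "\<dots> \<le> \<epsilon>" using N N0 assms(2) by (simp add: field_simps)
    finally show ?thesis .
  qed
  ultimately show thesis using that by blast
qed

definition race_sum :: "(complex \<Rightarrow> complex) \<Rightarrow> complex set \<Rightarrow> real \<Rightarrow> real" where
  "race_sum g Z u = Re (\<Sum>\<rho>\<in>Z. g \<rho> / \<rho> * cis (Im \<rho> * u))"

lemma race_sum_shift:
  assumes "\<And>\<rho>. \<rho> \<in> Z \<Longrightarrow> norm (cis (Im \<rho> * \<tau>) - 1) \<le> \<epsilon>"
    and "(\<Sum>\<rho>\<in>Z. norm (g \<rho>) / norm \<rho>) \<le> A" and "\<epsilon> \<ge> 0"
  shows "\<bar>race_sum g Z (u + \<tau>) - race_sum g Z u\<bar> \<le> \<epsilon> * A"
proof -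
  have "race_sum g Z (u + \<tau>) - race_sum g Z u =
        Re (\<Sum>\<rho>\<in>Z. g \<rho> / \<rho> * cis (Im \<rho> * u) * (cis (Im \<rho> * \<tau>) - 1))"
    by (simp add: race_sum_def distrib_left cis_mult[symmetric] right_diff_distrib
        sum_subtractf[symmetric] mult.assoc)
  also have "\<bar>\<dots>\<bar> \<le> norm (\<Sum>\<rho>\<in>Z. g \<rho> / \<rho> * cis (Im \<rho> * u) * (cis (Im \<rho> * \<tau>) - 1))"
    by (rule abs_Re_le_cmod)
  also have "\<dots> \<le> (\<Sum>\<rho>\<in>Z. norm (g \<rho>) / norm \<rho> * \<epsilon>)"
  proof (intro sum_norm_le)
    fix \<rho> assume "\<rho> \<in> Z"
    then show "norm (g \<rho> / \<rho> * cis (Im \<rho> * u) * (cis (Im \<rho> * \<tau>) - 1)) \<le> norm (g \<rho>) / norm \<rho> * \<epsilon>"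
      unfolding norm_mult norm_divide norm_cis mult_1_right
      using assms(1) by (intro mult_left_mono) auto
  qed
  also have "\<dots> = \<epsilon> * (\<Sum>\<rho>\<in>Z. norm (g \<rho>) / norm \<rho>)"
    by (simp only: sum_distrib_left mult.commute)
  also have "\<dots> \<le> \<epsilon> * A"
    using assms(2,3) by (rule mult_left_mono)
  finally show ?thesis .
qed

text \<open>Here \<open>p\<close>, \<open>p * x\<close>, \<open>p * y\<close>, \<open>p * x * y\<close> are the amplitudes that one zero contributes to the four
sums.  For \<open>x = t\<close> and \<open>\<bar>y\<bar> = s\<close> the expression is \<open>p\<^sup>2 (1 - t - s - t s) = 0\<close>, and it is antitone in
\<open>x\<close> and in \<open>\<bar>y\<bar>\<close>.\<close>

lemma square_gap:
  fixes p x y t s :: real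
  assumes "0 \<le> x" "x \<le> t" "\<bar>y\<bar> \<le> s" "t > 0" "s > 0" and ts: "t + s + t * s = 1"
  shows "0 \<le> p\<^sup>2 - (p * x)\<^sup>2 / t - (p * y)\<^sup>2 / s - (p * x * y)\<^sup>2 / (t * s)"
    and "x < t \<Longrightarrow> p \<noteq> 0 \<Longrightarrow> 0 < p\<^sup>2 - (p * x)\<^sup>2 / t - (p * y)\<^sup>2 / s - (p * x * y)\<^sup>2 / (t * s)"
proof -
  have "y\<^sup>2 \<le> s\<^sup>2" using assms by (metis abs_le_square_iff abs_of_pos)
  then have y: "y\<^sup>2 / s \<le> s" using assms by (simp add: field_simps power2_eq_square)
  have xt: "x\<^sup>2 / t * (y\<^sup>2 / s) \<le> x\<^sup>2 / t * s" using assms y by (intro mult_left_mono) auto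
  have eq: "1 - s = t * (1 + s)" using ts by (simp add: algebra_simps)
  have "1 - x\<^sup>2 / t - y\<^sup>2 / s - x\<^sup>2 / t * (y\<^sup>2 / s) \<ge> 1 - s - x\<^sup>2 / t * (1 + s)"
    using y xt unfolding distrib_left by linarith
  then have low: "1 - x\<^sup>2 / t - y\<^sup>2 / s - x\<^sup>2 / t * (y\<^sup>2 / s) \<ge> (1 + s) * (t - x\<^sup>2 / t)"
    unfolding eq by (simp add: algebra_simps)
  have split: "p\<^sup>2 - (p * x)\<^sup>2 / t - (p * y)\<^sup>2 / s - (p * x * y)\<^sup>2 / (t * s) =
     p\<^sup>2 * (1 - x\<^sup>2 / t - y\<^sup>2 / s - x\<^sup>2 / t * (y\<^sup>2 / s))"
    by (simp add: power_mult_distrib algebra_simps)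
  have "x\<^sup>2 \<le> t\<^sup>2" using assms by (simp add: power_mono)
  then have "x\<^sup>2 / t \<le> t" using assms by (simp add: field_simps power2_eq_square)
  then have "0 \<le> (1 + s) * (t - x\<^sup>2 / t)" using assms by simp
  then show "0 \<le> p\<^sup>2 - (p * x)\<^sup>2 / t - (p * y)\<^sup>2 / s - (p * x * y)\<^sup>2 / (t * s)"
    unfolding split using low by (intro mult_nonneg_nonneg) auto
  assume "x < t" "p \<noteq> 0"
  then have "x\<^sup>2 < t\<^sup>2" using assms by (intro power_strict_mono) auto
  then have "x\<^sup>2 / t < t" using assms by (simp add: field_simps power2_eq_square)
  then have "0 < (1 + s) * (t - x\<^sup>2 / t)" using assms by simp
  then show "0 < p\<^sup>2 - (p * x)\<^sup>2 / t - (p * y)\<^sup>2 / s - (p * x * y)\<^sup>2 / (t * s)"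
    unfolding split using low \<open>p \<noteq> 0\<close> by (intro mult_pos_pos) auto
qed

text \<open>These are the values \<open>t = tan (pi / 12)\<close> and \<open>s = tan (pi / 6)\<close>, and the first identity is the
addition formula for \<open>tan (pi / 12 + pi / 6) = 1\<close>.\<close>

lemma tan_weights:
  defines "t \<equiv> 2 - sqrt 3" and "s \<equiv> 1 / sqrt 3"
  shows "t + s + t * s = 1" "t > 0" "s > 0" "t * (2 + sqrt 3) = 1"
proof -
  have 3: "sqrt 3 * sqrt 3 = 3" by simp
  have s3: "s * sqrt 3 = 1" by (simp add: s_def)
  then have "s * 3 = sqrt 3" using 3 by (metis mult.assoc mult_1)
  then show "t + s + t * s = 1" using s3 by (simp add: t_def algebra_simps)
  have "sqrt 3 < sqrt 4" by (intro real_sqrt_less_mono) simp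
  then show "t > 0" by (simp add: t_def)
  show "s > 0" by (simp add: s_def)
  show "t * (2 + sqrt 3) = 1" using 3 by (simp add: t_def algebra_simps)
qed

text \<open>The amplitudes of \<open>sin (Im \<rho> * u)\<close> and \<open>cos (Im \<rho> * u)\<close> in the real part of
\<open>g \<rho> / \<rho> * cis (Im \<rho> * u)\<close>.  The two main ones come from \<open>Re (g \<rho>)\<close> and survive conjugation of
\<open>g \<rho>\<close>; the two skew ones come from \<open>Im (g \<rho>)\<close> and change sign.  When \<open>Re (g \<rho>) < 0 < Im \<rho>\<close>,
\<open>sin_main\<close> is positive, and the quotients of \<open>cos_main\<close> and \<open>cos_skew\<close> by it are \<open>Re \<rho> / Im \<rho>\<close> and
\<open>- Im (g \<rho>) / Re (g \<rho>)\<close>; the quotient of \<open>sin_skew\<close> is the product of these two.\<close>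

definition sin_main :: "(complex \<Rightarrow> complex) \<Rightarrow> complex \<Rightarrow> real" where
  "sin_main g \<rho> = - Re (g \<rho>) * Im \<rho> / (norm \<rho>)\<^sup>2"
definition cos_main :: "(complex \<Rightarrow> complex) \<Rightarrow> complex \<Rightarrow> real" where
  "cos_main g \<rho> = - Re (g \<rho>) * Re \<rho> / (norm \<rho>)\<^sup>2"
definition cos_skew :: "(complex \<Rightarrow> complex) \<Rightarrow> complex \<Rightarrow> real" where
  "cos_skew g \<rho> = Im (g \<rho>) * Im \<rho> / (norm \<rho>)\<^sup>2"
definition sin_skew :: "(complex \<Rightarrow> complex) \<Rightarrow> complex \<Rightarrow> real" where
  "sin_skew g \<rho> = Im (g \<rho>) * Re \<rho> / (norm \<rho>)\<^sup>2"

lemma race_sum_decompose: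
  "race_sum g Z u =
     - (\<Sum>\<rho>\<in>Z. sin_main g \<rho> * sin (Im \<rho> * u)) - (\<Sum>\<rho>\<in>Z. cos_main g \<rho> * cos (Im \<rho> * u))
     + (\<Sum>\<rho>\<in>Z. cos_skew g \<rho> * cos (Im \<rho> * u)) - (\<Sum>\<rho>\<in>Z. sin_skew g \<rho> * sin (Im \<rho> * u))"
  "race_sum (\<lambda>\<rho>. cnj (g \<rho>)) Z u =
     - (\<Sum>\<rho>\<in>Z. sin_main g \<rho> * sin (Im \<rho> * u)) - (\<Sum>\<rho>\<in>Z. cos_main g \<rho> * cos (Im \<rho> * u))
     - (\<Sum>\<rho>\<in>Z. cos_skew g \<rho> * cos (Im \<rho> * u)) + (\<Sum>\<rho>\<in>Z. sin_skew g \<rho> * sin (Im \<rho> * u))"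
proof -
  have *: "Re (h / \<rho> * cis v) =
      - (- Re h * Im \<rho> / (norm \<rho>)\<^sup>2 * sin v) - - Re h * Re \<rho> / (norm \<rho>)\<^sup>2 * cos v
      + Im h * Im \<rho> / (norm \<rho>)\<^sup>2 * cos v - Im h * Re \<rho> / (norm \<rho>)\<^sup>2 * sin v" for h \<rho> v
    by (simp add: Re_divide Im_divide cmod_power2 add_divide_distrib diff_divide_distrib
        algebra_simps)
  show "race_sum g Z u =
     - (\<Sum>\<rho>\<in>Z. sin_main g \<rho> * sin (Im \<rho> * u)) - (\<Sum>\<rho>\<in>Z. cos_main g \<rho> * cos (Im \<rho> * u))
     + (\<Sum>\<rho>\<in>Z. cos_skew g \<rho> * cos (Im \<rho> * u)) - (\<Sum>\<rho>\<in>Z. sin_skew g \<rho> * sin (Im \<rho> * u))"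
    unfolding race_sum_def Re_sum * sin_main_def cos_main_def sin_skew_def cos_skew_def
      sum.distrib sum_subtractf sum_negf ..
  show "race_sum (\<lambda>\<rho>. cnj (g \<rho>)) Z u =
     - (\<Sum>\<rho>\<in>Z. sin_main g \<rho> * sin (Im \<rho> * u)) - (\<Sum>\<rho>\<in>Z. cos_main g \<rho> * cos (Im \<rho> * u))
     - (\<Sum>\<rho>\<in>Z. cos_skew g \<rho> * cos (Im \<rho> * u)) + (\<Sum>\<rho>\<in>Z. sin_skew g \<rho> * sin (Im \<rho> * u))"
    unfolding race_sum_def Re_sum * sin_main_def cos_main_def sin_skew_def cos_skew_def
      sum.distrib sum_subtractf sum_negf complex_cnj
    by (simp add: sum_negf)
qed

text \<open>The heart of the proof.  A zero with \<open>\<beta> / Im \<rho> < t\<close> makes the mean square inequality strict by an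
amount that persists in every finite set containing it.  If there is no such zero, then
\<open>2 + sqrt 3 \<le> Im \<rho> \<le> (2 + sqrt 3) * \<beta>\<close> with \<open>\<beta> \<le> 1\<close> leaves only one point, for which the mean square
comparison may be an equality but the cosines can be made to vanish.\<close>

lemma main_sine_dominates:
  fixes g :: "complex \<Rightarrow> complex" and Z0 :: "complex set"
  assumes \<beta>: "0 < \<beta>" "\<beta> \<le> 1" and ne: "Z0 \<noteq> {}"
    and Re: "\<And>\<rho>. \<rho> \<in> Z0 \<Longrightarrow> Re \<rho> = \<beta>"
    and Im: "\<And>\<rho>. \<rho> \<in> Z0 \<Longrightarrow> Im \<rho> \<ge> 2 + sqrt 3"
    and g: "\<And>\<rho>. \<rho> \<in> Z0 \<Longrightarrow> Re (g \<rho>) < 0"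
      "\<And>\<rho>. \<rho> \<in> Z0 \<Longrightarrow> sqrt 3 * \<bar>Im (g \<rho>)\<bar> \<le> - Re (g \<rho>)"
    and A: "\<And>Z. finite Z \<Longrightarrow> Z \<subseteq> Z0 \<Longrightarrow> (\<Sum>\<rho>\<in>Z. norm (g \<rho>) / norm \<rho>) \<le> A"
  obtains \<rho>0 \<delta> where "\<rho>0 \<in> Z0" "\<delta> > 0"
    "\<And>Z. finite Z \<Longrightarrow> \<rho>0 \<in> Z \<Longrightarrow> Z \<subseteq> Z0 \<Longrightarrow> \<exists>u.
       \<bar>\<Sum>\<rho>\<in>Z. sin_main g \<rho> * sin (Im \<rho> * u)\<bar> \<ge> \<bar>\<Sum>\<rho>\<in>Z. cos_main g \<rho> * cos (Im \<rho> * u)\<bar>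
       + \<bar>\<Sum>\<rho>\<in>Z. cos_skew g \<rho> * cos (Im \<rho> * u)\<bar>
       + \<bar>\<Sum>\<rho>\<in>Z. sin_skew g \<rho> * sin (Im \<rho> * u)\<bar> + \<delta>"
proof -
  define t where "t = 2 - sqrt 3"
  define s where "s = 1 / sqrt 3"
  note ts = tan_weights[folded t_def s_def]
  have "2 + sqrt 3 > 0" by (simp add: add_pos_nonneg)
  have facts: "sin_main g \<rho> > 0" "cos_main g \<rho> = sin_main g \<rho> * (\<beta> / Im \<rho>)"
    "cos_skew g \<rho> = sin_main g \<rho> * (Im (g \<rho>) / - Re (g \<rho>))"
    "sin_skew g \<rho> = sin_main g \<rho> * (\<beta> / Im \<rho>) * (Im (g \<rho>) / - Re (g \<rho>))"
    "0 \<le> \<beta> / Im \<rho>" "\<beta> / Im \<rho> \<le> t" "\<bar>Im (g \<rho>) / - Re (g \<rho>)\<bar> \<le> s"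
    "Im \<rho> > 0" "sin_main g \<rho> \<le> norm (g \<rho>) / norm \<rho>"
    "Im \<rho> > (2 + sqrt 3) * \<beta> \<Longrightarrow> \<beta> / Im \<rho> < t" if "\<rho> \<in> Z0" for \<rho>
  proof -
    show pos: "Im \<rho> > 0" using Im[OF that] \<open>2 + sqrt 3 > 0\<close> by linarith
    then have "\<rho> \<noteq> 0" by auto
    with pos g(1)[OF that] show "sin_main g \<rho> > 0"
      unfolding sin_main_def by (intro divide_pos_pos mult_pos_pos) auto
    show "cos_main g \<rho> = sin_main g \<rho> * (\<beta> / Im \<rho>)"
      "cos_skew g \<rho> = sin_main g \<rho> * (Im (g \<rho>) / - Re (g \<rho>))"
      "sin_skew g \<rho> = sin_main g \<rho> * (\<beta> / Im \<rho>) * (Im (g \<rho>) / - Re (g \<rho>))"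
      using pos g(1)[OF that] Re[OF that]
      by (simp_all add: sin_main_def cos_main_def cos_skew_def sin_skew_def)
    show "0 \<le> \<beta> / Im \<rho>" using \<beta> pos by simp
    have "\<beta> = t * ((2 + sqrt 3) * \<beta>)" using ts(4) by (metis mult.assoc mult_1)
    moreover have "(2 + sqrt 3) * \<beta> \<le> Im \<rho>"
      using Im[OF that] \<beta> \<open>2 + sqrt 3 > 0\<close> by (smt (verit) mult_left_le)
    ultimately show "\<beta> / Im \<rho> \<le> t" using pos ts(2) by (metis mult_left_mono pos_divide_le_eq less_imp_le)
    show "\<beta> / Im \<rho> < t" if "Im \<rho> > (2 + sqrt 3) * \<beta>"
      using \<open>\<beta> = t * ((2 + sqrt 3) * \<beta>)\<close> that pos ts(2)
      by (metis mult_strict_left_mono pos_divide_less_eq)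
    show "\<bar>Im (g \<rho>) / - Re (g \<rho>)\<bar> \<le> s"
      using g[OF that] by (simp add: s_def field_simps)
    have "- Re (g \<rho>) * Im \<rho> \<le> norm (g \<rho>) * norm \<rho>"
      using g(1)[OF that] pos abs_Re_le_cmod[of "g \<rho>"] abs_Im_le_cmod[of \<rho>]
      by (intro mult_mono) auto
    then have "sin_main g \<rho> \<le> norm (g \<rho>) * norm \<rho> / (norm \<rho>)\<^sup>2"
      unfolding sin_main_def by (intro divide_right_mono) auto
    then show "sin_main g \<rho> \<le> norm (g \<rho>) / norm \<rho>"
      using \<open>\<rho> \<noteq> 0\<close> by (simp add: power2_eq_square)
  qed
  show thesis
  proof (cases "\<exists>\<rho>\<in>Z0. Im \<rho> > (2 + sqrt 3) * \<beta>")
    case True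
    then obtain \<rho>0 where \<rho>0: "\<rho>0 \<in> Z0" "Im \<rho>0 > (2 + sqrt 3) * \<beta>" by blast
    (* q is the contribution of one zero to the mean value in sine_sum_dominates *)
    define q where "q = (\<lambda>\<rho>. ((sin_main g \<rho>)\<^sup>2 - (cos_main g \<rho>)\<^sup>2 / t - (cos_skew g \<rho>)\<^sup>2 / s
      - (sin_skew g \<rho>)\<^sup>2 / (t * s)) / 2)"
    have q_nonneg: "q \<rho> \<ge> 0" if "\<rho> \<in> Z0" for \<rho>
      using square_gap(1)[OF facts(5-7)[OF that] ts(2,3,1)]
      unfolding q_def facts(2-4)[OF that] by simp
    have q_pos: "q \<rho>0 > 0"
      using square_gap(2)[OF facts(5-7)[OF \<rho>0(1)] ts(2,3,1) facts(10)[OF \<rho>0]]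
        facts(1)[OF \<rho>0(1)]
      unfolding q_def facts(2-4)[OF \<rho>0(1)] by simp
    have "A \<ge> 0" using A[of "{}"] by simp
    show thesis
    proof (rule that[OF \<rho>0(1)])
      show "q \<rho>0 / 2 / (2 * (A + 1)) > 0" using q_pos \<open>A \<ge> 0\<close> by simp
      fix Z assume Z: "finite Z" "\<rho>0 \<in> Z" "Z \<subseteq> Z0"
      have "q \<rho>0 / 2 < q \<rho>0" using q_pos by simp
      also have "q \<rho>0 \<le> (\<Sum>\<rho>\<in>Z. q \<rho>)"
        using Z q_nonneg by (intro member_le_sum) auto
      finally have gap: "q \<rho>0 / 2 < (\<Sum>\<rho>\<in>Z. q \<rho>)" .
      have "(\<Sum>\<rho>\<in>Z. \<bar>sin_main g \<rho>\<bar>) \<le> (\<Sum>\<rho>\<in>Z. norm (g \<rho>) / norm \<rho>)"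
        using facts(1,9) Z by (intro sum_mono) (auto simp: less_imp_le subset_iff)
      then have bd: "(\<Sum>\<rho>\<in>Z. \<bar>sin_main g \<rho>\<bar>) \<le> A + 1" using A[OF Z(1,3)] by linarith
      have inj: "inj_on Im Z"
        using Z Re by (auto intro!: inj_onI complex_eqI simp: subset_iff)
      show "\<exists>u. \<bar>\<Sum>\<rho>\<in>Z. sin_main g \<rho> * sin (Im \<rho> * u)\<bar> \<ge> \<bar>\<Sum>\<rho>\<in>Z. cos_main g \<rho> * cos (Im \<rho> * u)\<bar>
       + \<bar>\<Sum>\<rho>\<in>Z. cos_skew g \<rho> * cos (Im \<rho> * u)\<bar>
       + \<bar>\<Sum>\<rho>\<in>Z. sin_skew g \<rho> * sin (Im \<rho> * u)\<bar> + q \<rho>0 / 2 / (2 * (A + 1))"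
        by (rule sine_sum_dominates[OF Z(1) inj _ ts(2,3) _ _ gap[unfolded q_def] _ bd])
          (use facts(8) Z ts q_pos in \<open>auto simp: q_def\<close>)
    qed
  next
    case False
    obtain \<rho>0 where \<rho>0: "\<rho>0 \<in> Z0" using ne by blast
    have "\<rho> = Complex 1 (2 + sqrt 3)" if "\<rho> \<in> Z0" for \<rho>
    proof -
      have "2 + sqrt 3 \<le> Im \<rho>" "Im \<rho> \<le> (2 + sqrt 3) * \<beta>" using Im that False by force+
      moreover from this have "\<beta> = 1"
        using \<beta> \<open>2 + sqrt 3 > 0\<close> by (smt (verit) mult_less_cancel_left2)
      ultimately show ?thesis using Re[OF that] by (auto intro!: complex_eqI)
    qed
    then have single: "Z0 = {\<rho>0}" using \<rho>0 by auto
    define \<delta> where "\<delta> = sin_main g \<rho>0 - \<bar>sin_skew g \<rho>0\<bar>"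
    have "\<bar>sin_skew g \<rho>0\<bar> \<le> sin_main g \<rho>0 * t * s"
      unfolding facts(4)[OF \<rho>0] abs_mult using facts[OF \<rho>0] ts
      by (intro mult_mono) auto
    also have "\<dots> < sin_main g \<rho>0 * 1"
      using facts(1)[OF \<rho>0] ts unfolding mult.assoc
      by (intro mult_strict_left_mono) (auto simp: add_pos_pos intro: order.strict_trans2)
    finally have "\<delta> > 0" by (simp add: \<delta>_def)
    show thesis
    proof (rule that[OF \<rho>0 \<open>\<delta> > 0\<close>])
      fix Z assume "finite Z" "\<rho>0 \<in> Z" "Z \<subseteq> Z0"
      then have "Z = {\<rho>0}" using single by auto
      moreover have "Im \<rho>0 * (pi / (2 * Im \<rho>0)) = pi / 2" using facts(8)[OF \<rho>0] by simp
      ultimately show "\<exists>u. \<bar>\<Sum>\<rho>\<in>Z. sin_main g \<rho> * sin (Im \<rho> * u)\<bar> \<ge> \<bar>\<Sum>\<rho>\<in>Z. cos_main g \<rho> * cos (Im \<rho> * u)\<bar>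
       + \<bar>\<Sum>\<rho>\<in>Z. cos_skew g \<rho> * cos (Im \<rho> * u)\<bar>
       + \<bar>\<Sum>\<rho>\<in>Z. sin_skew g \<rho> * sin (Im \<rho> * u)\<bar> + \<delta>"
        using facts(1,8)[OF \<rho>0] by (intro exI[of _ "pi / (2 * Im \<rho>0)"]) (simp add: \<delta>_def)
    qed
  qed
qed

text \<open>Once the main sine sum dominates at \<open>u\<close>, its sign decides the signs of both race sums at \<open>u\<close>, and
it decides them the other way at \<open>- u\<close>.  An almost period carries both points beyond \<open>T\<close> at the cost
of half of the margin.\<close>

lemma race_sums_same_sign:
  fixes g :: "complex \<Rightarrow> complex" and Z0 :: "complex set"
  assumes "0 < \<beta>" "\<beta> \<le> 1" "Z0 \<noteq> {}"
    and "\<And>\<rho>. \<rho> \<in> Z0 \<Longrightarrow> Re \<rho> = \<beta>"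
    and "\<And>\<rho>. \<rho> \<in> Z0 \<Longrightarrow> Im \<rho> \<ge> 2 + sqrt 3"
    and "\<And>\<rho>. \<rho> \<in> Z0 \<Longrightarrow> Re (g \<rho>) < 0"
      "\<And>\<rho>. \<rho> \<in> Z0 \<Longrightarrow> sqrt 3 * \<bar>Im (g \<rho>)\<bar> \<le> - Re (g \<rho>)"
    and A: "\<And>Z. finite Z \<Longrightarrow> Z \<subseteq> Z0 \<Longrightarrow> (\<Sum>\<rho>\<in>Z. norm (g \<rho>) / norm \<rho>) \<le> A"
  obtains \<rho>0 \<delta> where "\<rho>0 \<in> Z0" "\<delta> > 0"
    "\<And>Z T. finite Z \<Longrightarrow> \<rho>0 \<in> Z \<Longrightarrow> Z \<subseteq> Z0 \<Longrightarrow>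
       (\<exists>u\<ge>T. race_sum g Z u \<ge> \<delta> \<and> race_sum (\<lambda>\<rho>. cnj (g \<rho>)) Z u \<ge> \<delta>) \<and>
       (\<exists>u\<ge>T. race_sum g Z u \<le> - \<delta> \<and> race_sum (\<lambda>\<rho>. cnj (g \<rho>)) Z u \<le> - \<delta>)"
proof -
  obtain \<rho>0 \<delta> where \<rho>0: "\<rho>0 \<in> Z0" "\<delta> > 0"
    and dom: "\<And>Z. finite Z \<Longrightarrow> \<rho>0 \<in> Z \<Longrightarrow> Z \<subseteq> Z0 \<Longrightarrow> \<exists>u.
       \<bar>\<Sum>\<rho>\<in>Z. sin_main g \<rho> * sin (Im \<rho> * u)\<bar> \<ge> \<bar>\<Sum>\<rho>\<in>Z. cos_main g \<rho> * cos (Im \<rho> * u)\<bar>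
       + \<bar>\<Sum>\<rho>\<in>Z. cos_skew g \<rho> * cos (Im \<rho> * u)\<bar>
       + \<bar>\<Sum>\<rho>\<in>Z. sin_skew g \<rho> * sin (Im \<rho> * u)\<bar> + \<delta>"
    using main_sine_dominates[OF assms] by blast
  show thesis
  proof (rule that[of \<rho>0 "\<delta> / 2"])
    show "\<rho>0 \<in> Z0" "\<delta> / 2 > 0" using \<rho>0 by auto
    fix Z T assume Z: "finite Z" "\<rho>0 \<in> Z" "Z \<subseteq> Z0"
    let ?g' = "\<lambda>\<rho>. cnj (g \<rho>)"
    obtain u where u: "\<bar>\<Sum>\<rho>\<in>Z. sin_main g \<rho> * sin (Im \<rho> * u)\<bar> \<ge>
       \<bar>\<Sum>\<rho>\<in>Z. cos_main g \<rho> * cos (Im \<rho> * u)\<bar>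
       + \<bar>\<Sum>\<rho>\<in>Z. cos_skew g \<rho> * cos (Im \<rho> * u)\<bar>
       + \<bar>\<Sum>\<rho>\<in>Z. sin_skew g \<rho> * sin (Im \<rho> * u)\<bar> + \<delta>"
      using dom[OF Z] by blast
    have "(race_sum g Z u \<le> - \<delta> \<and> race_sum ?g' Z u \<le> - \<delta> \<and>
           race_sum g Z (- u) \<ge> \<delta> \<and> race_sum ?g' Z (- u) \<ge> \<delta>) \<or>
          (race_sum g Z (- u) \<le> - \<delta> \<and> race_sum ?g' Z (- u) \<le> - \<delta> \<and>
           race_sum g Z u \<ge> \<delta> \<and> race_sum ?g' Z u \<ge> \<delta>)"
      using u unfolding race_sum_decompose(2)[of g] race_sum_decompose(1)[of g]
      by (simp add: sum_negf) linarith
    then obtain v w where vw: "race_sum g Z v \<le> - \<delta>" "race_sum ?g' Z v \<le> - \<delta>"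
      "race_sum g Z w \<ge> \<delta>" "race_sum ?g' Z w \<ge> \<delta>" by blast
    have "A \<ge> 0" using A[of "{}"] by simp
    define \<epsilon> where "\<epsilon> = \<delta> / (2 * (A + 1))"
    have \<epsilon>: "\<epsilon> > 0" using \<rho>0 \<open>A \<ge> 0\<close> by (simp add: \<epsilon>_def)
    have "\<epsilon> * A \<le> \<epsilon> * (A + 1)" using \<epsilon> by simp
    also have "\<dots> = \<delta> / 2" using \<open>A \<ge> 0\<close> by (simp add: \<epsilon>_def field_simps)
    finally have \<epsilon>A: "\<epsilon> * A \<le> \<delta> / 2" .
    obtain \<tau> where \<tau>: "\<tau> \<ge> max (T - v) (T - w)"
      "\<And>\<rho>. \<rho> \<in> Z \<Longrightarrow> norm (cis (Im \<rho> * \<tau>) - 1) \<le> \<epsilon>"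
      using almost_period[OF Z(1) \<epsilon>] by blast
    have shift: "\<bar>race_sum g Z (x + \<tau>) - race_sum g Z x\<bar> \<le> \<delta> / 2"
      "\<bar>race_sum ?g' Z (x + \<tau>) - race_sum ?g' Z x\<bar> \<le> \<delta> / 2" for x
      using race_sum_shift[of Z \<tau> \<epsilon> g A x] race_sum_shift[of Z \<tau> \<epsilon> ?g' A x]
        \<tau>(2) A[OF Z(1,3)] \<epsilon> \<epsilon>A by auto
    have "w + \<tau> \<ge> T" "v + \<tau> \<ge> T" using \<tau>(1) by auto
    moreover have "race_sum g Z (w + \<tau>) \<ge> \<delta> / 2" "race_sum ?g' Z (w + \<tau>) \<ge> \<delta> / 2"
      "race_sum g Z (v + \<tau>) \<le> - (\<delta> / 2)" "race_sum ?g' Z (v + \<tau>) \<le> - (\<delta> / 2)"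
      using shift[of v] shift[of w] vw by linarith+
    ultimately show "(\<exists>u\<ge>T. race_sum g Z u \<ge> \<delta> / 2 \<and> race_sum ?g' Z u \<ge> \<delta> / 2) \<and>
       (\<exists>u\<ge>T. race_sum g Z u \<le> - (\<delta> / 2) \<and> race_sum ?g' Z u \<le> - (\<delta> / 2))" by blast
  qed
qed

section \<open>The contribution of one zero and of all zeros of a character\<close>

lemma powr_of_real_polar:
  assumes "t > 0"
  shows "of_real t powr \<rho> = of_real (t powr Re \<rho>) * cis (Im \<rho> * ln t)"
  using assms
  by (simp add: powr_def exp_eq_polar Ln_of_real mult.commute)

lemma integral_powr_minus_one_le:
  fixes b x :: real
  assumes "0 < b" "2 \<le> x"
  shows "(\<lambda>t. t powr (b - 1)) integrable_on {2..x}"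
    and "integral {2..x} (\<lambda>t. t powr (b - 1)) \<le> x powr b / b"
proof -
  have "((\<lambda>t. t powr (b - 1)) has_integral (x powr b / b - 2 powr b / b)) {2..x}"
    using assms
    by (intro fundamental_theorem_of_calculus)
       (auto intro!: derivative_eq_intros simp: has_real_derivative_iff_has_vector_derivative[symmetric])
  then show "(\<lambda>t. t powr (b - 1)) integrable_on {2..x}"
    and "integral {2..x} (\<lambda>t. t powr (b - 1)) \<le> x powr b / b"
    using assms by (auto simp: integral_unique has_integral_integrable)
qed

text \<open>The factor \<open>ln x / x powr \<beta>\<close> times a bound for the integral in the definition of \<open>f_zero\<close> that is
uniform in all \<open>\<rho>\<close> with \<open>0 < Re \<rho> \<le> \<beta>\<close>.\<close>

definition zero_error :: "real \<Rightarrow> real \<Rightarrow> real" where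
  "zero_error \<beta> x =
     (2 * x powr (3 / 4 * \<beta>) / (\<beta> * (ln 2)\<^sup>2) + 4 * x powr \<beta> / (\<beta> * (ln x)\<^sup>2)) * ln x / x powr \<beta>"

lemma zero_error_tendsto_0:
  assumes "\<beta> > 0"
  shows "(zero_error \<beta> \<longlongrightarrow> 0) at_top"
  using assms unfolding zero_error_def by real_asymp

lemma zero_error_nonneg: "\<beta> > 0 \<Longrightarrow> x \<ge> 2 \<Longrightarrow> zero_error \<beta> x \<ge> 0"
  unfolding zero_error_def by (intro divide_nonneg_nonneg mult_nonneg_nonneg add_nonneg_nonneg) auto

text \<open>The integral is of smaller order because the factor \<open>1 / (ln t)\<^sup>2\<close> is at most \<open>4 / (ln x)\<^sup>2\<close> for
\<open>t \<ge> sqrt x\<close>, while the range \<open>t \<le> sqrt x\<close> saves a power of \<open>x\<close>.\<close>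

lemma f_zero_estimate:
  assumes \<rho>: "0 < Re \<rho>" "Re \<rho> \<le> \<beta>" and x: "x \<ge> 2"
  shows "norm (of_real (ln x / x powr \<beta>) * f_zero x \<rho> -
               of_real (x powr (Re \<rho> - \<beta>)) * cis (Im \<rho> * ln x) / \<rho>) \<le> zero_error \<beta> x / norm \<rho>"
proof -
  define J where "J = integral {2..x} (\<lambda>t. of_real t powr \<rho> / of_real (t * (ln t)\<^sup>2))"
  have "\<beta> > 0" using \<rho> by simp
  have "\<rho> \<noteq> 0" using \<rho> by auto
  have lnx: "ln x > 0" using x by simp
  (* The first summand dominates the integrand for t below sqrt x, the second one above it;
     adding both avoids splitting the integral. *)
  define h where "h = (\<lambda>t. x powr (\<beta> / 4) / (ln 2)\<^sup>2 * t powr (\<beta> / 2 - 1) + 4 / (ln x)\<^sup>2 * t powr (\<beta> - 1))"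
  have h1: "(\<lambda>t. x powr (\<beta> / 4) / (ln 2)\<^sup>2 * t powr (\<beta> / 2 - 1)) integrable_on {2..x}"
    using integral_powr_minus_one_le(1)[of "\<beta> / 2" x] \<open>\<beta> > 0\<close> x by simp
  have h2: "(\<lambda>t. 4 / (ln x)\<^sup>2 * t powr (\<beta> - 1)) integrable_on {2..x}"
    using integral_powr_minus_one_le(1)[of "\<beta>" x] \<open>\<beta> > 0\<close> x by simp
  have h_int: "h integrable_on {2..x}"
    unfolding h_def using h1 h2 by (rule integrable_add)
  have "integral {2..x} h = x powr (\<beta> / 4) / (ln 2)\<^sup>2 * integral {2..x} (\<lambda>t. t powr (\<beta> / 2 - 1))
      + 4 / (ln x)\<^sup>2 * integral {2..x} (\<lambda>t. t powr (\<beta> - 1))"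
    unfolding h_def integral_add[OF h1 h2] by simp
  also have "\<dots> \<le> x powr (\<beta> / 4) / (ln 2)\<^sup>2 * (x powr (\<beta> / 2) / (\<beta> / 2))
      + 4 / (ln x)\<^sup>2 * (x powr \<beta> / \<beta>)"
    using \<open>\<beta> > 0\<close> x by (intro add_mono mult_left_mono integral_powr_minus_one_le) auto
  also have "\<dots> = 2 * (x powr (\<beta> / 4) * x powr (\<beta> / 2)) / (\<beta> * (ln 2)\<^sup>2) + 4 * x powr \<beta> / (\<beta> * (ln x)\<^sup>2)"
    by (simp add: field_simps)
  also have "x powr (\<beta> / 4) * x powr (\<beta> / 2) = x powr (3 / 4 * \<beta>)"
    by (simp add: powr_add[symmetric])
  finally have h_le: "integral {2..x} h \<le>
     2 * x powr (3 / 4 * \<beta>) / (\<beta> * (ln 2)\<^sup>2) + 4 * x powr \<beta> / (\<beta> * (ln x)\<^sup>2)" .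
  have "norm J \<le> integral {2..x} h"
    unfolding J_def
  proof (rule integral_norm_bound_integral[OF _ h_int])
    show "(\<lambda>t. of_real t powr \<rho> / of_real (t * (ln t)\<^sup>2)) integrable_on {2..x}"
      by (intro integrable_continuous_real continuous_intros) auto
    fix t assume t: "t \<in> {2..x}"
    then have lnt: "ln t > 0" "t > 0" by auto
    have "norm (of_real t powr \<rho> / of_real (t * (ln t)\<^sup>2)) = t powr Re \<rho> / (t * (ln t)\<^sup>2)"
      using lnt by (simp add: powr_of_real_polar norm_mult norm_divide norm_power)
    also have "\<dots> \<le> t powr \<beta> / (t * (ln t)\<^sup>2)"
      using \<rho> t by (intro divide_right_mono powr_mono) auto
    also have "\<dots> = t powr (\<beta> - 1) / (ln t)\<^sup>2"
      using lnt by (simp add: powr_diff)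
    also have "\<dots> \<le> h t"
    proof (cases "t\<^sup>2 \<le> x")
      case True
      have "t powr (\<beta> / 2) = (t powr 2) powr (\<beta> / 4)" by (simp only: powr_powr) simp
      also have "t powr 2 = t\<^sup>2" using lnt by simp
      also have "(t\<^sup>2) powr (\<beta> / 4) \<le> x powr (\<beta> / 4)"
        using True \<open>\<beta> > 0\<close> by (intro powr_mono2) auto
      finally have "t powr (\<beta> / 2) * t powr (\<beta> / 2 - 1) \<le> x powr (\<beta> / 4) * t powr (\<beta> / 2 - 1)"
        by (intro mult_right_mono) auto
      then have "t powr (\<beta> - 1) \<le> x powr (\<beta> / 4) * t powr (\<beta> / 2 - 1)"
        by (simp add: powr_add[symmetric])
      then have "t powr (\<beta> - 1) / (ln t)\<^sup>2 \<le> x powr (\<beta> / 4) * t powr (\<beta> / 2 - 1) / (ln 2)\<^sup>2"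
        using t by (intro frac_le power_mono) auto
      also have "\<dots> \<le> h t" by (simp add: h_def)
      finally show ?thesis .
    next
      case False
      then have "ln x < ln (t\<^sup>2)" using x lnt by simp
      then have "ln x / 2 \<le> ln t" using lnt by (simp add: ln_realpow)
      then have "(ln x / 2)\<^sup>2 \<le> (ln t)\<^sup>2" using lnx by (intro power_mono) auto
      then have "t powr (\<beta> - 1) / (ln t)\<^sup>2 \<le> t powr (\<beta> - 1) / (ln x / 2)\<^sup>2"
        using lnx by (intro divide_left_mono mult_pos_pos) (use lnt in auto)
      also have "\<dots> = 4 / (ln x)\<^sup>2 * t powr (\<beta> - 1)" by (simp add: power_divide)
      also have "\<dots> \<le> h t" by (simp add: h_def)
      finally show ?thesis .
    qed
    finally show "norm (of_real t powr \<rho> / of_real (t * (ln t)\<^sup>2)) \<le> h t" .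
  qed
  with h_le have J: "norm J \<le> 2 * x powr (3 / 4 * \<beta>) / (\<beta> * (ln 2)\<^sup>2) + 4 * x powr \<beta> / (\<beta> * (ln x)\<^sup>2)"
    by linarith
  have xpos: "x powr \<beta> > 0" using x by simp
  have "of_real (ln x / x powr \<beta>) * f_zero x \<rho> =
        of_real (x powr Re \<rho> / x powr \<beta>) * cis (Im \<rho> * ln x) / \<rho> + of_real (ln x / x powr \<beta>) * J / \<rho>"
    using x lnx \<open>\<rho> \<noteq> 0\<close> xpos unfolding f_zero_def J_def[symmetric]
    by (simp add: powr_of_real_polar distrib_left)
  also have "x powr Re \<rho> / x powr \<beta> = x powr (Re \<rho> - \<beta>)" by (simp add: powr_diff)
  finally have "norm (of_real (ln x / x powr \<beta>) * f_zero x \<rho> -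
               of_real (x powr (Re \<rho> - \<beta>)) * cis (Im \<rho> * ln x) / \<rho>) =
               norm J * (ln x / x powr \<beta>) / norm \<rho>"
    using lnx xpos by (simp add: norm_mult norm_divide)
  also have "\<dots> \<le> zero_error \<beta> x / norm \<rho>"
    unfolding zero_error_def times_divide_eq_right[symmetric]
    using J lnx xpos by (intro divide_right_mono mult_right_mono) auto
  finally show ?thesis .
qed

text \<open>Dominated convergence in a truncated form: after division by \<open>x powr \<beta> / ln x\<close>, each summand is
bounded by \<open>c \<rho> / norm \<rho>\<close> up to a constant and those with \<open>Re \<rho> < \<beta>\<close> tend to \<open>0\<close>, so for a
large enough finite set \<open>F\<close> only its zeros on the line \<open>Re \<rho> = \<beta>\<close> matter.  The statement holds for all
larger finite sets, which allows one set to serve all characters.\<close>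

lemma f_zero_sum_approx:
  fixes c :: "complex \<Rightarrow> real"
  assumes \<beta>: "\<beta> > 0" and Re: "\<And>\<rho>. \<rho> \<in> S \<Longrightarrow> 0 < Re \<rho> \<and> Re \<rho> \<le> \<beta>"
    and c: "\<And>\<rho>. c \<rho> \<ge> 0" and summ: "(\<lambda>\<rho>. c \<rho> / norm \<rho>) summable_on S" and "\<epsilon> > 0"
  obtains F0 where "finite F0" "F0 \<subseteq> S"
    "\<And>F. finite F \<Longrightarrow> F0 \<subseteq> F \<Longrightarrow> F \<subseteq> S \<Longrightarrow> \<forall>\<^sub>F x in at_top.
       norm (of_real (ln x / x powr \<beta>) * (\<Sum>\<^sub>\<infinity>\<rho>\<in>S. of_real (c \<rho>) * f_zero x \<rho>)
             - (\<Sum>\<rho>\<in>{\<rho>\<in>F. Re \<rho> = \<beta>}. of_real (c \<rho>) / \<rho> * cis (Im \<rho> * ln x))) < \<epsilon>"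
proof -
  define M where "M = (\<lambda>\<rho>. c \<rho> / norm \<rho>)"
  have M0: "M \<rho> \<ge> 0" for \<rho> using c by (simp add: M_def)
  have summM: "M summable_on S" using summ by (simp add: M_def)
  define K where "K = infsum M S"
  obtain F0 where F0: "finite F0" "F0 \<subseteq> S" "dist (sum M F0) (infsum M S) \<le> \<epsilon> / 2"
    using infsum_finite_approximation[OF summM, of "\<epsilon> / 2"] \<open>\<epsilon> > 0\<close> by auto
  show thesis
  proof (rule that[OF F0(1,2)])
    fix F assume F: "finite F" "F0 \<subseteq> F" "F \<subseteq> S"
    have "sum M F0 \<le> sum M F" using F M0 by (intro sum_mono2) auto
    moreover have "infsum M (S - F) = K - sum M F"
      using F summM by (simp add: K_def infsum_Diff)
    ultimately have tail: "infsum M (S - F) \<le> \<epsilon> / 2"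
      using F0(3) unfolding K_def dist_real_def by linarith
    have summT: "M summable_on (S - F)"
      using summM summable_on_subset_banach by blast
    have "sum M F \<le> K" unfolding K_def using F M0 summM by (intro finite_sum_le_infsum) auto
    define R where "R = (\<lambda>x. \<Sum>\<rho>\<in>{\<rho>\<in>F. Re \<rho> \<noteq> \<beta>}. M \<rho> * x powr (Re \<rho> - \<beta>))"
    have "((\<lambda>x. x powr (Re \<rho> - \<beta>)) \<longlongrightarrow> 0) at_top" if "\<rho> \<in> F" "Re \<rho> \<noteq> \<beta>" for \<rho>
      using Re[of \<rho>] that F by (intro tendsto_neg_powr filterlim_ident) auto
    then have "(R \<longlongrightarrow> (\<Sum>\<rho>\<in>{\<rho>\<in>F. Re \<rho> \<noteq> \<beta>}. M \<rho> * 0)) at_top"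
      unfolding R_def by (intro tendsto_sum tendsto_mult tendsto_const) auto
    then have "((\<lambda>x. K * zero_error \<beta> x + R x + (1 + zero_error \<beta> x) * (\<epsilon> / 2)) \<longlongrightarrow>
          K * 0 + 0 + (1 + 0) * (\<epsilon> / 2)) at_top"
      by (intro tendsto_intros zero_error_tendsto_0 \<beta>) auto
    then have "\<forall>\<^sub>F x in at_top. K * zero_error \<beta> x + R x + (1 + zero_error \<beta> x) * (\<epsilon> / 2) < \<epsilon>"
      by (rule order_tendstoD(2)) (use \<open>\<epsilon> > 0\<close> in simp)
    then show "\<forall>\<^sub>F x in at_top.
       norm (of_real (ln x / x powr \<beta>) * (\<Sum>\<^sub>\<infinity>\<rho>\<in>S. of_real (c \<rho>) * f_zero x \<rho>)
             - (\<Sum>\<rho>\<in>{\<rho>\<in>F. Re \<rho> = \<beta>}. of_real (c \<rho>) / \<rho> * cis (Im \<rho> * ln x))) < \<epsilon>"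
      using eventually_ge_at_top[of 2]
    proof eventually_elim
      case (elim x)
      define s where "s = (\<lambda>\<rho>. of_real (ln x / x powr \<beta>) * (of_real (c \<rho>) * f_zero x \<rho>))"
      define m where "m = (\<lambda>\<rho>. of_real (x powr (Re \<rho> - \<beta>)) * (of_real (c \<rho>) / \<rho> * cis (Im \<rho> * ln x)))"
      define E where "E = zero_error \<beta> x"
      have E0: "E \<ge> 0" using zero_error_nonneg[OF \<beta> elim(2)] by (simp add: E_def)
      have norm_m: "norm (m \<rho>) = M \<rho> * x powr (Re \<rho> - \<beta>)" for \<rho>
        using c[of \<rho>] by (simp add: m_def M_def norm_mult norm_divide)
      have sm: "norm (s \<rho> - m \<rho>) \<le> M \<rho> * E" if "\<rho> \<in> S" for \<rho>
      proof -
        have "s \<rho> - m \<rho> = of_real (c \<rho>) * (of_real (ln x / x powr \<beta>) * f_zero x \<rho> -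
               of_real (x powr (Re \<rho> - \<beta>)) * cis (Im \<rho> * ln x) / \<rho>)"
          by (simp add: s_def m_def algebra_simps)
        also have "norm \<dots> \<le> c \<rho> * (E / norm \<rho>)"
          unfolding norm_mult[of "of_real (c \<rho>)"] E_def norm_of_real abs_of_nonneg[OF c]
          using Re[OF that] elim(2) by (intro mult_left_mono f_zero_estimate c) auto
        finally show ?thesis by (simp add: M_def)
      qed
      have s_le: "norm (s \<rho>) \<le> M \<rho> * (1 + E)" if "\<rho> \<in> S" for \<rho>
      proof -
        have "x powr (Re \<rho> - \<beta>) \<le> x powr 0"
          using Re[OF that] elim(2) by (intro powr_mono) auto
        then have "x powr (Re \<rho> - \<beta>) \<le> 1" using elim(2) by simp
        then have "norm (m \<rho>) \<le> M \<rho>" unfolding norm_m using M0 by (simp add: mult_left_le)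
        then show ?thesis using sm[OF that] norm_triangle_sub[of "s \<rho>" "m \<rho>"]
          by (simp add: algebra_simps)
      qed
      have summs: "(\<lambda>\<rho>. norm (s \<rho>)) summable_on A" if "A \<subseteq> S" for A
      proof (rule Infinite_Sum.abs_summable_on_comparison_test')
        show "(\<lambda>\<rho>. M \<rho> * (1 + E)) summable_on A"
          using summable_on_subset_banach[OF summM that] by (rule summable_on_cmult_left)
      qed (use s_le that in auto)
      have "norm (infsum s (S - F)) \<le> (\<Sum>\<^sub>\<infinity>\<rho>\<in>S - F. norm (s \<rho>))"
        by (rule norm_infsum_bound[OF summs]) auto
      also have "\<dots> \<le> (\<Sum>\<^sub>\<infinity>\<rho>\<in>S - F. M \<rho> * (1 + E))"
        using s_le by (intro infsum_mono summs summable_on_cmult_left summT) auto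
      also have "\<dots> = infsum M (S - F) * (1 + E)"
        using summT by (intro infsum_cmult_left) auto
      also have "\<dots> \<le> \<epsilon> / 2 * (1 + E)" using tail E0 by (intro mult_right_mono) auto
      finally have 1: "norm (infsum s (S - F)) \<le> (1 + E) * (\<epsilon> / 2)" by (simp add: mult.commute)
      have "norm (\<Sum>\<rho>\<in>F. s \<rho> - m \<rho>) \<le> (\<Sum>\<rho>\<in>F. M \<rho> * E)"
        using sm F by (intro sum_norm_le) auto
      also have "\<dots> = sum M F * E" by (simp add: sum_distrib_right)
      also have "\<dots> \<le> K * E" using \<open>sum M F \<le> K\<close> E0 by (rule mult_right_mono)
      finally have 2: "norm (\<Sum>\<rho>\<in>F. s \<rho> - m \<rho>) \<le> K * E" .
      have 3: "norm (\<Sum>\<rho>\<in>{\<rho>\<in>F. Re \<rho> \<noteq> \<beta>}. m \<rho>) \<le> R x"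
        unfolding R_def by (intro sum_norm_le) (simp add: norm_m)
      have "infsum s S = infsum s (S - F) + sum s F"
        using infsum_Diff[of s S F] F abs_summable_summable[OF summs] by simp
      also have "sum s F = (\<Sum>\<rho>\<in>F. s \<rho> - m \<rho>) + sum m F" by (simp add: sum_subtractf)
      also have "sum m F = (\<Sum>\<rho>\<in>{\<rho>\<in>F. Re \<rho> = \<beta>}. m \<rho>) + (\<Sum>\<rho>\<in>{\<rho>\<in>F. Re \<rho> \<noteq> \<beta>}. m \<rho>)"
        using F(1) by (subst sum.union_disjoint[symmetric]) (auto intro!: sum.cong)
      also have "(\<Sum>\<rho>\<in>{\<rho>\<in>F. Re \<rho> = \<beta>}. m \<rho>) =
          (\<Sum>\<rho>\<in>{\<rho>\<in>F. Re \<rho> = \<beta>}. of_real (c \<rho>) / \<rho> * cis (Im \<rho> * ln x))"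
        using elim(2) by (intro sum.cong) (auto simp: m_def)
      finally have "norm (infsum s S - (\<Sum>\<rho>\<in>{\<rho>\<in>F. Re \<rho> = \<beta>}. of_real (c \<rho>) / \<rho> * cis (Im \<rho> * ln x)))
         = norm (infsum s (S - F) + (\<Sum>\<rho>\<in>F. s \<rho> - m \<rho>) + (\<Sum>\<rho>\<in>{\<rho>\<in>F. Re \<rho> \<noteq> \<beta>}. m \<rho>))"
        by (simp add: algebra_simps)
      also have "\<dots> \<le> (1 + E) * (\<epsilon> / 2) + K * E + R x"
        using 1 2 3 by (intro norm_triangle_le add_mono) auto
      also have "\<dots> < \<epsilon>" using elim(1) by (simp add: E_def)
      finally show ?case
        unfolding s_def by (subst (asm) infsum_cmult_right') simp
    qed
  qed
qed

section \<open>Characters on a cyclic group of order three\<close>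

lemma cube_root_of_unity:
  fixes w :: complex
  assumes "w ^ 3 = 1"
  shows "cnj (w\<^sup>2) = w" "norm w = 1"
    "sqrt 3 * \<bar>Im (w - 1)\<bar> = - Re (w - 1)" "w \<noteq> 1 \<Longrightarrow> Re (w - 1) < 0"
proof -
  have "norm w ^ 3 = 1" using assms by (metis norm_one norm_power)
  then show n: "norm w = 1" using power_eq_1_iff by fastforce
  then have "w * cnj w = w * w\<^sup>2"
    using assms by (simp add: complex_norm_square[symmetric] power3_eq_cube power2_eq_square mult.assoc)
  moreover have "w \<noteq> 0" using n by auto
  ultimately have c: "cnj w = w\<^sup>2" by (metis mult_left_cancel)
  then show "cnj (w\<^sup>2) = w" by (metis complex_cnj_cnj)
  have xy: "(Re w)\<^sup>2 + (Im w)\<^sup>2 = 1" using n by (metis cmod_power2 power_one)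
  have "Re w = (Re w)\<^sup>2 - (Im w)\<^sup>2" using arg_cong[OF c, of Re] by (simp add: Re_power2)
  then have "(2 * Re w + 1) * (Re w - 1) = 0"
    using xy by (simp add: algebra_simps power2_eq_square)
  then consider "Re w = 1" | "Re w = - 1 / 2" by fastforce
  then have "sqrt 3 * \<bar>Im (w - 1)\<bar> = - Re (w - 1) \<and> (w \<noteq> 1 \<longrightarrow> Re (w - 1) < 0)"
  proof cases
    case 1
    then show ?thesis using xy by (auto simp: complex_eq_iff)
  next
    case 2
    then have "(2 * \<bar>Im w\<bar>)\<^sup>2 = 3" using xy by (simp add: power2_eq_square)
    then have "2 * \<bar>Im w\<bar> = sqrt 3" by (intro real_sqrt_unique[symmetric]) auto
    then have "\<bar>Im w\<bar> = sqrt 3 / 2" by simp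
    then have "sqrt 3 * \<bar>Im w\<bar> = 3 / 2" by (simp only: times_divide_eq_right) simp
    then show ?thesis using 2 by simp
  qed
  then show "sqrt 3 * \<bar>Im (w - 1)\<bar> = - Re (w - 1)" "w \<noteq> 1 \<Longrightarrow> Re (w - 1) < 0" by auto
qed

lemma dirichlet_char_mod:
  assumes "dirichlet_char q \<psi>"
  shows "\<psi> (m mod int q) = \<psi> m"
proof -
  have per: "\<psi> (n + int q) = \<psi> n" for n using assms by (simp add: dirichlet_char_def)
  have nat: "\<psi> (n + int k * int q) = \<psi> n" for n k
  proof (induction k)
    case (Suc k)
    then show ?case using per[of "n + int k * int q"] by (simp add: algebra_simps)
  qed simp
  have "\<psi> (m mod int q) = \<psi> (m mod int q + int (nat (m div int q)) * int q)"
    by (rule nat[symmetric])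
  also have "\<dots> = \<psi> (m + int (nat (- (m div int q))) * int q)"
    by (rule arg_cong[of _ _ \<psi>], cases "m div int q \<ge> 0")
       (simp_all add: mod_mult_div_eq minus_div_mult_eq_mod[symmetric] algebra_simps)
  also have "\<dots> = \<psi> m" by (rule nat)
  finally show ?thesis .
qed

lemma dirichlet_char_one:
  assumes "dirichlet_char q \<psi>"
  shows "\<psi> 1 = 1"
proof -
  have "\<psi> 1 \<noteq> 0" using assms by (simp add: dirichlet_char_def)
  moreover have "\<psi> 1 = \<psi> 1 * \<psi> 1" using assms by (metis dirichlet_char_def mult_1)
  ultimately show ?thesis by simp
qed

lemma dirichlet_char_pow:
  assumes "dirichlet_char q \<psi>"
  shows "\<psi> (a [^]\<^bsub>reduced_residues q\<^esub> (n::nat)) = \<psi> a ^ n"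
proof (induction n)
  case 0
  show ?case using dirichlet_char_one[OF assms]
    by (simp add: nat_pow_def reduced_residues_def units_of_def residue_ring_def)
next
  case (Suc n)
  have "a [^]\<^bsub>reduced_residues q\<^esub> Suc n = (a [^]\<^bsub>reduced_residues q\<^esub> n * a) mod int q"
    by (simp add: nat_pow_def reduced_residues_def units_of_def residue_ring_def)
  then show ?case
    using Suc assms by (simp add: dirichlet_char_mod[OF assms]) (simp add: dirichlet_char_def)
qed

lemma cube_eq_one_in_subgroup:
  assumes "q \<ge> 2" and "subgroup G (reduced_residues q)" "card G = 3" "a \<in> G"
  shows "a [^]\<^bsub>reduced_residues q\<^esub> (3::nat) = 1"
proof -
  interpret R: residues "int q" "residue_ring (int q)"
    using assms(1) by unfold_locales auto
  interpret U: group "reduced_residues q"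
    unfolding reduced_residues_def by (rule R.units_group)
  interpret H: group "(reduced_residues q)\<lparr>carrier := G\<rparr>"
    by (rule subgroup.subgroup_is_group[OF assms(2) U.is_group])
  have "a [^]\<^bsub>(reduced_residues q)\<lparr>carrier := G\<rparr>\<^esub> order ((reduced_residues q)\<lparr>carrier := G\<rparr>) =
        \<one>\<^bsub>(reduced_residues q)\<lparr>carrier := G\<rparr>\<^esub>"
    using assms by (intro H.pow_order_eq_1) auto
  then show ?thesis
    using assms(3) U.nat_pow_consistent[of a "3::nat" G]
    by (simp add: order_def) (simp add: reduced_residues_def units_of_def residue_ring_def)
qed

lemma occurrences_eq_0: "\<rho> \<notin> zeros B \<psi> \<Longrightarrow> occurrences B \<rho> \<psi> = 0"
  by (auto simp: zeros_def occurrences_def)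

lemma occurrences_pos:
  assumes "is_system q B" "\<psi> \<in> nonprincipal_chars q" "\<rho> \<in> zeros B \<psi>"
  shows "occurrences B \<rho> \<psi> > 0"
  using assms by (auto simp: is_system_def zeros_def occurrences_def card_gt_0_iff)

text \<open>The prime counting term is the same for all residue classes and cancels.\<close>

lemma P_sys_diff:
  assumes "\<And>\<psi>. \<psi> \<in> nonprincipal_chars q \<Longrightarrow> \<psi> 1 = 1"
  shows "P_sys q B b x - P_sys q B 1 x = - (2 / real (totient q)) *
    Re (\<Sum>\<psi>\<in>nonprincipal_chars q. (cnj (\<psi> b) - 1) *
      (\<Sum>\<^sub>\<infinity>\<rho>\<in>zeros B \<psi>. of_real (weight \<rho>) * of_nat (occurrences B \<rho> \<psi>) * f_zero x \<rho>))"
proof -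
  have "(\<Sum>\<psi>\<in>nonprincipal_chars q. (cnj (\<psi> b) - 1) * W \<psi>) =
      (\<Sum>\<psi>\<in>nonprincipal_chars q. conj_char \<psi> b * W \<psi>) -
      (\<Sum>\<psi>\<in>nonprincipal_chars q. conj_char \<psi> 1 * W \<psi>)" for W :: "_ \<Rightarrow> complex"
    unfolding sum_subtractf[symmetric]
    by (intro sum.cong) (simp_all add: conj_char_def left_diff_distrib assms)
  then show ?thesis unfolding P_sys_def by (simp add: right_diff_distrib)
qed

section \<open>Oscillation of the two differences\<close>

text \<open>All that the cyclic group of order three contributes is that each character maps \<open>a\<close> to a cube root
of unity.\<close>

locale cubic_race =
  fixes q :: nat and B :: zero_system and a :: int
  assumes q_pos: "q > 0" and sys: "is_system q B"
    and char_one: "\<psi> \<in> nonprincipal_chars q \<Longrightarrow> \<psi> 1 = 1"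
    and char_cube: "\<psi> \<in> nonprincipal_chars q \<Longrightarrow> \<psi> a ^ 3 = 1"
    and z_nonempty: "z_sys q B a 1 \<noteq> {}"
    and z_Im: "\<rho> \<in> z_sys q B a 1 \<Longrightarrow> Im \<rho> \<ge> 2 + sqrt 3"
begin

abbreviation "X \<equiv> nonprincipal_chars q"
abbreviation "n \<rho> \<psi> \<equiv> occurrences B \<rho> \<psi>"
abbreviation "g \<rho> \<equiv> g_sys q B \<rho> a 1"
abbreviation "\<beta> \<equiv> beta_sys q B a 1"
abbreviation "Z0 \<equiv> z_sys q B a 1"

lemma g_eq: "g \<rho> = (\<Sum>\<psi>\<in>X. of_nat (n \<rho> \<psi>) * (\<psi> a - 1))"
  unfolding g_sys_def by (intro sum.cong) (simp_all add: char_one)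

text \<open>A sum over an infinite set is \<open>0\<close> by convention, so a single \<open>\<rho>\<close> with \<open>g \<rho> \<noteq> 0\<close> shows finiteness.\<close>
lemma finite_X: "finite X"
proof -
  obtain \<rho> where "\<rho> \<in> Z0" using z_nonempty by blast
  then have "g \<rho> \<noteq> 0" by (auto simp: z_sys_def)
  then show ?thesis unfolding g_sys_def using sum.infinite by blast
qed

text \<open>For \<open>\<psi> a \<noteq> 1\<close>, the number \<open>\<psi> a - 1\<close> has real part \<open>- 3 / 2\<close> and imaginary part \<open>sqrt 3 / 2\<close> or
\<open>- sqrt 3 / 2\<close>; it lies on the boundary of the sector, and the sector is a convex cone.\<close>

lemma g_sector: "sqrt 3 * \<bar>Im (g \<rho>)\<bar> \<le> - Re (g \<rho>)"
proof -
  have "sqrt 3 * \<bar>Im (g \<rho>)\<bar> \<le> sqrt 3 * (\<Sum>\<psi>\<in>X. \<bar>real (n \<rho> \<psi>) * Im (\<psi> a - 1)\<bar>)"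
    unfolding g_eq Im_sum by (intro mult_left_mono order_trans[OF sum_abs]) auto
  also have "\<dots> = (\<Sum>\<psi>\<in>X. real (n \<rho> \<psi>) * (sqrt 3 * \<bar>Im (\<psi> a - 1)\<bar>))"
    unfolding sum_distrib_left by (intro sum.cong) (simp_all add: abs_mult)
  also have "\<dots> = (\<Sum>\<psi>\<in>X. real (n \<rho> \<psi>) * - Re (\<psi> a - 1))"
    using cube_root_of_unity(3)[OF char_cube] by (intro sum.cong) auto
  also have "\<dots> = - Re (g \<rho>)"
    unfolding g_eq Re_sum sum_negf[symmetric] by (intro sum.cong) (simp_all add: algebra_simps)
  finally show ?thesis .
qed

lemma Re_g_neg: "g \<rho> \<noteq> 0 \<Longrightarrow> Re (g \<rho>) < 0"
proof -
  assume nz: "g \<rho> \<noteq> 0"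
  have "sqrt 3 * \<bar>Im (g \<rho>)\<bar> \<ge> 0" by simp
  then have "Re (g \<rho>) \<le> 0" using g_sector[of \<rho>] by linarith
  moreover have "Re (g \<rho>) \<noteq> 0"
  proof
    assume "Re (g \<rho>) = 0"
    then have "sqrt 3 * \<bar>Im (g \<rho>)\<bar> \<le> 0" using g_sector[of \<rho>] by simp
    then have "Im (g \<rho>) = 0" by (simp add: mult_le_0_iff)
    with \<open>Re (g \<rho>) = 0\<close> nz show False by (simp add: complex_eq_iff)
  qed
  ultimately show ?thesis by simp
qed

text \<open>All summands of \<open>g \<rho>\<close> have real part at most \<open>0\<close>, and the one of \<open>\<psi>\<close> has negative real part.  Thus
characters with \<open>\<psi> a \<noteq> 1\<close> have no zeros to the right of \<open>\<beta>\<close>.\<close>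

lemma g_nonzero:
  assumes "\<psi> \<in> X" "\<psi> a \<noteq> 1" "\<rho> \<in> zeros B \<psi>"
  shows "g \<rho> \<noteq> 0"
proof -
  have le: "Re (\<phi> a - 1) \<le> 0" if "\<phi> \<in> X" for \<phi>
    using cube_root_of_unity(3)[OF char_cube[OF that]] by (smt (verit) mult_nonneg_nonneg real_sqrt_ge_zero)
  have "Re (g \<rho>) = real (n \<rho> \<psi>) * Re (\<psi> a - 1) + (\<Sum>\<phi>\<in>X - {\<psi>}. real (n \<rho> \<phi>) * Re (\<phi> a - 1))"
    unfolding g_eq Re_sum using sum.remove[OF finite_X assms(1)] by simp
  moreover have "real (n \<rho> \<psi>) * Re (\<psi> a - 1) < 0"
    using occurrences_pos[OF sys assms(1,3)] cube_root_of_unity(4)[OF char_cube[OF assms(1)] assms(2)]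
    by (intro mult_pos_neg) auto
  moreover have "(\<Sum>\<phi>\<in>X - {\<psi>}. real (n \<rho> \<phi>) * Re (\<phi> a - 1)) \<le> 0"
    using le by (intro sum_nonpos mult_nonneg_nonpos) auto
  ultimately show ?thesis by force
qed

lemma g_nonzero_in_all_zeros: "g \<rho> \<noteq> 0 \<Longrightarrow> \<rho> \<in> all_zeros q B"
proof (rule ccontr)
  assume "g \<rho> \<noteq> 0" "\<rho> \<notin> all_zeros q B"
  then show False
    by (auto simp: g_eq all_zeros_def occurrences_eq_0)
qed

lemma Re_zero_ge: "\<rho> \<in> all_zeros q B \<Longrightarrow> R_minus q B \<le> Re \<rho>"
  unfolding R_minus_def using sys by (intro cInf_lower) (auto simp: is_system_def)

lemma Re_zero_le: "\<rho> \<in> all_zeros q B \<Longrightarrow> Re \<rho> \<le> R_plus q B"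
  unfolding R_plus_def using sys by (intro cSup_upper) (auto simp: is_system_def)

lemma Re_le_beta:
  assumes "g \<rho> \<noteq> 0"
  shows "Re \<rho> \<le> \<beta>"
  unfolding beta_sys_def
  using assms g_nonzero_in_all_zeros Re_zero_le
  by (intro cSup_upper) (auto intro!: bdd_aboveI2[of _ _ "R_plus q B"])

lemma beta_bounds: "R_minus q B \<le> \<beta>" "0 < \<beta>" "\<beta> \<le> 1"
proof -
  obtain \<rho> where "\<rho> \<in> Z0" using z_nonempty by blast
  then have "Re \<rho> = \<beta>" "\<rho> \<in> all_zeros q B" by (auto simp: z_sys_def all_zeros_def)
  with Re_zero_ge[of \<rho>] Re_zero_le[of \<rho>] sys
  show "R_minus q B \<le> \<beta>" "0 < \<beta>" "\<beta> \<le> 1" by (auto simp: is_system_def)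
qed

lemma zeros_Re:
  assumes "\<psi> \<in> X" "\<psi> a \<noteq> 1" "\<rho> \<in> zeros B \<psi>"
  shows "0 < Re \<rho>" "Re \<rho> \<le> \<beta>" "Re \<rho> = \<beta> \<Longrightarrow> \<rho> \<in> Z0"
proof -
  have "\<rho> \<in> all_zeros q B" using assms by (auto simp: all_zeros_def)
  from Re_zero_ge[OF this] sys show "0 < Re \<rho>" by (auto simp: is_system_def)
  show "Re \<rho> \<le> \<beta>" using Re_le_beta[OF g_nonzero[OF assms]] .
  show "Re \<rho> = \<beta> \<Longrightarrow> \<rho> \<in> Z0" using assms g_nonzero[OF assms] by (auto simp: z_sys_def)
qed

lemma weight_Z0: "\<rho> \<in> Z0 \<Longrightarrow> weight \<rho> = 1"
proof -
  assume "\<rho> \<in> Z0"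
  from z_Im[OF this] have "Im \<rho> > 0" by (smt (verit) real_sqrt_ge_zero)
  then show "weight \<rho> = 1" by (auto simp: weight_def complex_is_Real_iff)
qed

lemma summable_zeros:
  "\<psi> \<in> X \<Longrightarrow> (\<lambda>\<rho>. real (n \<rho> \<psi>) / norm \<rho>) summable_on zeros B \<psi>"
  using sys by (auto simp: is_system_def)

definition zero_sum :: "(int \<Rightarrow> complex) \<Rightarrow> real \<Rightarrow> complex" where
  "zero_sum \<psi> x = (\<Sum>\<^sub>\<infinity>\<rho>\<in>zeros B \<psi>. of_real (weight \<rho>) * of_nat (n \<rho> \<psi>) * f_zero x \<rho>)"

lemma zero_sum_approx:
  assumes "\<psi> \<in> X" "\<psi> a \<noteq> 1" "\<epsilon> > 0"
  obtains Z1 where "finite Z1" "Z1 \<subseteq> Z0"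
    "\<And>Z. finite Z \<Longrightarrow> Z1 \<subseteq> Z \<Longrightarrow> Z \<subseteq> Z0 \<Longrightarrow> \<forall>\<^sub>F x in at_top.
       norm (of_real (ln x / x powr \<beta>) * zero_sum \<psi> x
             - (\<Sum>\<rho>\<in>Z. of_nat (n \<rho> \<psi>) / \<rho> * cis (Im \<rho> * ln x))) < \<epsilon>"
proof -
  define c where "c = (\<lambda>\<rho>. weight \<rho> * real (n \<rho> \<psi>))"
  have c0: "c \<rho> \<ge> 0" for \<rho> by (simp add: c_def weight_def)
  have "(\<lambda>\<rho>. norm (c \<rho> / norm \<rho>)) summable_on zeros B \<psi>"
    using summable_zeros[OF assms(1)]
  proof (rule Infinite_Sum.abs_summable_on_comparison_test')
    fix \<rho>
    have "c \<rho> \<le> real (n \<rho> \<psi>)" by (simp add: c_def weight_def)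
    then show "norm (c \<rho> / norm \<rho>) \<le> real (n \<rho> \<psi>) / norm \<rho>"
      using c0[of \<rho>] by (simp add: divide_right_mono)
  qed
  then have summ: "(\<lambda>\<rho>. c \<rho> / norm \<rho>) summable_on zeros B \<psi>" by (rule abs_summable_summable)
  have Re: "0 < Re \<rho> \<and> Re \<rho> \<le> \<beta>" if "\<rho> \<in> zeros B \<psi>" for \<rho>
    using zeros_Re[OF assms(1,2) that] by simp
  obtain F0 where F0: "finite F0" "F0 \<subseteq> zeros B \<psi>"
    and app: "\<And>F. finite F \<Longrightarrow> F0 \<subseteq> F \<Longrightarrow> F \<subseteq> zeros B \<psi> \<Longrightarrow> \<forall>\<^sub>F x in at_top.
       norm (of_real (ln x / x powr \<beta>) * (\<Sum>\<^sub>\<infinity>\<rho>\<in>zeros B \<psi>. of_real (c \<rho>) * f_zero x \<rho>)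
             - (\<Sum>\<rho>\<in>{\<rho>\<in>F. Re \<rho> = \<beta>}. of_real (c \<rho>) / \<rho> * cis (Im \<rho> * ln x))) < \<epsilon>"
    using f_zero_sum_approx[OF beta_bounds(2) Re c0 summ \<open>\<epsilon> > 0\<close>] by blast
  show thesis
  proof (rule that[of "{\<rho>\<in>F0. Re \<rho> = \<beta>}"])
    show "finite {\<rho> \<in> F0. Re \<rho> = \<beta>}" using F0 by simp
    show "{\<rho> \<in> F0. Re \<rho> = \<beta>} \<subseteq> Z0" using F0(2) zeros_Re(3)[OF assms(1,2)] by auto
    fix Z assume Z: "finite Z" "{\<rho>\<in>F0. Re \<rho> = \<beta>} \<subseteq> Z" "Z \<subseteq> Z0"
    define F where "F = F0 \<union> (Z \<inter> zeros B \<psi>)"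
    have F: "finite F" "F0 \<subseteq> F" "F \<subseteq> zeros B \<psi>" using F0 Z by (auto simp: F_def)
    have FZ: "{\<rho>\<in>F. Re \<rho> = \<beta>} = Z \<inter> zeros B \<psi>"
      using Z F0 by (auto simp: F_def z_sys_def)
    have zero_sum_eq: "zero_sum \<psi> x = (\<Sum>\<^sub>\<infinity>\<rho>\<in>zeros B \<psi>. of_real (c \<rho>) * f_zero x \<rho>)" for x
      by (simp add: zero_sum_def c_def)
    have "(\<Sum>\<rho>\<in>{\<rho>\<in>F. Re \<rho> = \<beta>}. of_real (c \<rho>) / \<rho> * cis (Im \<rho> * ln x)) =
        (\<Sum>\<rho>\<in>Z. of_nat (n \<rho> \<psi>) / \<rho> * cis (Im \<rho> * ln x))" for x
      unfolding FZ
    proof (rule sum.mono_neutral_cong_left[OF Z(1)])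
      fix \<rho> assume "\<rho> \<in> Z \<inter> zeros B \<psi>"
      then show "of_real (c \<rho>) / \<rho> * cis (Im \<rho> * ln x) = of_nat (n \<rho> \<psi>) / \<rho> * cis (Im \<rho> * ln x)"
        using weight_Z0[of \<rho>] Z(3) by (auto simp: c_def)
    qed (auto simp: occurrences_eq_0)
    with app[OF F] show "\<forall>\<^sub>F x in at_top.
       norm (of_real (ln x / x powr \<beta>) * zero_sum \<psi> x
             - (\<Sum>\<rho>\<in>Z. of_nat (n \<rho> \<psi>) / \<rho> * cis (Im \<rho> * ln x))) < \<epsilon>"
      by (simp add: zero_sum_eq)
  qed
qed

lemma zero_sum_approx_uniform:
  assumes "\<epsilon> > 0"
  obtains Z1 where "finite Z1" "Z1 \<subseteq> Z0"
    "\<And>Z. finite Z \<Longrightarrow> Z1 \<subseteq> Z \<Longrightarrow> Z \<subseteq> Z0 \<Longrightarrow> \<forall>\<^sub>F x in at_top. \<forall>\<psi>\<in>{\<psi>\<in>X. \<psi> a \<noteq> 1}.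
       norm (of_real (ln x / x powr \<beta>) * zero_sum \<psi> x
             - (\<Sum>\<rho>\<in>Z. of_nat (n \<rho> \<psi>) / \<rho> * cis (Im \<rho> * ln x))) < \<epsilon>"
proof -
  define close where "close Z \<psi> x \<longleftrightarrow> norm (of_real (ln x / x powr \<beta>) * zero_sum \<psi> x
             - (\<Sum>\<rho>\<in>Z. of_nat (n \<rho> \<psi>) / \<rho> * cis (Im \<rho> * ln x))) < \<epsilon>" for Z \<psi> x
  have "\<exists>Z1. finite Z1 \<and> Z1 \<subseteq> Z0 \<and>
      (\<forall>Z. finite Z \<longrightarrow> Z1 \<subseteq> Z \<longrightarrow> Z \<subseteq> Z0 \<longrightarrow> eventually (close Z \<psi>) at_top)"
    if \<psi>: "\<psi> \<in> X" "\<psi> a \<noteq> 1" for \<psi>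
  proof -
    obtain Z1 where "finite Z1" "Z1 \<subseteq> Z0"
      "\<And>Z. finite Z \<Longrightarrow> Z1 \<subseteq> Z \<Longrightarrow> Z \<subseteq> Z0 \<Longrightarrow> eventually (close Z \<psi>) at_top"
       unfolding close_def by (rule zero_sum_approx[OF \<psi> assms]) blast
    then show ?thesis by blast
  qed
  then obtain Z1 where Z1: "\<And>\<psi>. \<psi> \<in> X \<Longrightarrow> \<psi> a \<noteq> 1 \<Longrightarrow> finite (Z1 \<psi>) \<and> Z1 \<psi> \<subseteq> Z0 \<and>
      (\<forall>Z. finite Z \<longrightarrow> Z1 \<psi> \<subseteq> Z \<longrightarrow> Z \<subseteq> Z0 \<longrightarrow> eventually (close Z \<psi>) at_top)"
    by metis
  have fin: "finite {\<psi>\<in>X. \<psi> a \<noteq> 1}" using finite_X by simp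
  show thesis
  proof (rule that[of "\<Union>\<psi>\<in>{\<psi>\<in>X. \<psi> a \<noteq> 1}. Z1 \<psi>"], unfold close_def[symmetric])
    show "finite (\<Union>\<psi>\<in>{\<psi>\<in>X. \<psi> a \<noteq> 1}. Z1 \<psi>)" using fin Z1 by blast
    show "(\<Union>\<psi>\<in>{\<psi>\<in>X. \<psi> a \<noteq> 1}. Z1 \<psi>) \<subseteq> Z0" using Z1 by blast
    fix Z assume Z: "finite Z" "(\<Union>\<psi>\<in>{\<psi>\<in>X. \<psi> a \<noteq> 1}. Z1 \<psi>) \<subseteq> Z" "Z \<subseteq> Z0"
    show "\<forall>\<^sub>F x in at_top. \<forall>\<psi>\<in>{\<psi>\<in>X. \<psi> a \<noteq> 1}. close Z \<psi> x"
    proof (rule eventually_ball_finite[OF fin], rule ballI)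
      fix \<psi> assume "\<psi> \<in> {\<psi>\<in>X. \<psi> a \<noteq> 1}"
      with Z Z1[of \<psi>] show "eventually (close Z \<psi>) at_top" by blast
    qed
  qed
qed

text \<open>The bound \<open>norm (\<psi> a - 1) \<le> 2\<close> reduces this to the convergence condition on the system.\<close>

lemma race_sum_bound:
  obtains A where "\<And>Z. finite Z \<Longrightarrow> Z \<subseteq> Z0 \<Longrightarrow> (\<Sum>\<rho>\<in>Z. norm (g \<rho>) / norm \<rho>) \<le> A"
proof
  fix Z assume Z: "finite Z" "Z \<subseteq> Z0"
  have "(\<Sum>\<rho>\<in>Z. norm (g \<rho>) / norm \<rho>) \<le> (\<Sum>\<rho>\<in>Z. \<Sum>\<psi>\<in>X. 2 * (real (n \<rho> \<psi>) / norm \<rho>))"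
  proof (rule sum_mono)
    fix \<rho>
    have "norm (g \<rho>) \<le> (\<Sum>\<psi>\<in>X. 2 * real (n \<rho> \<psi>))"
      unfolding g_eq
    proof (rule sum_norm_le)
      fix \<psi> assume "\<psi> \<in> X"
      have "norm (\<psi> a - 1) \<le> 2"
        using cube_root_of_unity(2)[OF char_cube[OF \<open>\<psi> \<in> X\<close>]] norm_triangle_ineq4[of "\<psi> a" 1] by simp
      then show "norm (of_nat (n \<rho> \<psi>) * (\<psi> a - 1)) \<le> 2 * real (n \<rho> \<psi>)"
        using mult_left_mono[of "norm (\<psi> a - 1)" 2 "real (n \<rho> \<psi>)"]
        by (simp add: norm_mult mult.commute)
    qed
    then have "norm (g \<rho>) / norm \<rho> \<le> (\<Sum>\<psi>\<in>X. 2 * real (n \<rho> \<psi>)) / norm \<rho>"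
      by (intro divide_right_mono) auto
    then show "norm (g \<rho>) / norm \<rho> \<le> (\<Sum>\<psi>\<in>X. 2 * (real (n \<rho> \<psi>) / norm \<rho>))"
      by (simp add: sum_divide_distrib)
  qed
  also have "\<dots> = (\<Sum>\<psi>\<in>X. 2 * (\<Sum>\<rho>\<in>Z. real (n \<rho> \<psi>) / norm \<rho>))"
    unfolding sum_distrib_left by (rule sum.swap)
  also have "\<dots> \<le> (\<Sum>\<psi>\<in>X. 2 * (\<Sum>\<^sub>\<infinity>\<rho>\<in>zeros B \<psi>. real (n \<rho> \<psi>) / norm \<rho>))"
  proof (intro sum_mono mult_left_mono)
    fix \<psi> assume "\<psi> \<in> X"
    have "(\<Sum>\<rho>\<in>Z. real (n \<rho> \<psi>) / norm \<rho>) = (\<Sum>\<rho>\<in>Z \<inter> zeros B \<psi>. real (n \<rho> \<psi>) / norm \<rho>)"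
      using Z(1) by (intro sum.mono_neutral_right) (auto simp: occurrences_eq_0)
    also have "\<dots> \<le> (\<Sum>\<^sub>\<infinity>\<rho>\<in>zeros B \<psi>. real (n \<rho> \<psi>) / norm \<rho>)"
      using Z(1) summable_zeros[OF \<open>\<psi> \<in> X\<close>] by (intro finite_sum_le_infsum) auto
    finally show "(\<Sum>\<rho>\<in>Z. real (n \<rho> \<psi>) / norm \<rho>) \<le> \<dots>" .
  qed simp
  finally show "(\<Sum>\<rho>\<in>Z. norm (g \<rho>) / norm \<rho>) \<le> \<dots>" .
qed

text \<open>Applied with \<open>\<kappa> \<psi> = cnj (\<psi> c) - 1\<close>, where \<open>c\<close> is \<open>a\<close> or its square.  The sum over characters and the
sum over zeros are interchanged only after truncation to a finite \<open>Z\<close>.\<close>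

lemma combination_approx:
  fixes \<kappa> :: "(int \<Rightarrow> complex) \<Rightarrow> complex"
  assumes \<kappa>: "\<And>\<psi>. \<psi> \<in> X \<Longrightarrow> \<psi> a = 1 \<Longrightarrow> \<kappa> \<psi> = 0" "\<And>\<psi>. \<psi> \<in> X \<Longrightarrow> norm (\<kappa> \<psi>) \<le> 2"
    and close: "\<forall>\<psi>\<in>{\<psi>\<in>X. \<psi> a \<noteq> 1}.
       norm (of_real (ln x / x powr \<beta>) * zero_sum \<psi> x
             - (\<Sum>\<rho>\<in>Z. of_nat (n \<rho> \<psi>) / \<rho> * cis (Im \<rho> * ln x))) < \<epsilon>" and "\<epsilon> > 0"
  shows "\<bar>ln x / x powr \<beta> * Re (\<Sum>\<psi>\<in>X. \<kappa> \<psi> * zero_sum \<psi> x) -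
          race_sum (\<lambda>\<rho>. \<Sum>\<psi>\<in>X. of_nat (n \<rho> \<psi>) * \<kappa> \<psi>) Z (ln x)\<bar> \<le> 2 * \<epsilon> * card X"
proof -
  define D where "D = (\<lambda>\<psi>. of_real (ln x / x powr \<beta>) * zero_sum \<psi> x
             - (\<Sum>\<rho>\<in>Z. of_nat (n \<rho> \<psi>) / \<rho> * cis (Im \<rho> * ln x)))"
  have swap: "(\<Sum>\<psi>\<in>X. \<kappa> \<psi> * (\<Sum>\<rho>\<in>Z. of_nat (n \<rho> \<psi>) / \<rho> * cis (Im \<rho> * ln x))) =
      (\<Sum>\<rho>\<in>Z. (\<Sum>\<psi>\<in>X. of_nat (n \<rho> \<psi>) * \<kappa> \<psi>) / \<rho> * cis (Im \<rho> * ln x))"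
    unfolding sum_distrib_left sum_distrib_right sum_divide_distrib
    by (subst sum.swap) (simp add: mult_ac)
  have "ln x / x powr \<beta> * Re (\<Sum>\<psi>\<in>X. \<kappa> \<psi> * zero_sum \<psi> x) =
        Re (of_real (ln x / x powr \<beta>) * (\<Sum>\<psi>\<in>X. \<kappa> \<psi> * zero_sum \<psi> x))" by simp
  also have "of_real (ln x / x powr \<beta>) * (\<Sum>\<psi>\<in>X. \<kappa> \<psi> * zero_sum \<psi> x) =
        (\<Sum>\<psi>\<in>X. \<kappa> \<psi> * (of_real (ln x / x powr \<beta>) * zero_sum \<psi> x))"
    unfolding sum_distrib_left by (simp add: mult_ac)
  finally have "ln x / x powr \<beta> * Re (\<Sum>\<psi>\<in>X. \<kappa> \<psi> * zero_sum \<psi> x) -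
          race_sum (\<lambda>\<rho>. \<Sum>\<psi>\<in>X. of_nat (n \<rho> \<psi>) * \<kappa> \<psi>) Z (ln x) = Re (\<Sum>\<psi>\<in>X. \<kappa> \<psi> * D \<psi>)"
    unfolding race_sum_def swap[symmetric] D_def right_diff_distrib sum_subtractf by simp
  also have "\<bar>\<dots>\<bar> \<le> norm (\<Sum>\<psi>\<in>X. \<kappa> \<psi> * D \<psi>)" by (rule abs_Re_le_cmod)
  also have "\<dots> \<le> (\<Sum>\<psi>\<in>X. 2 * \<epsilon>)"
  proof (rule sum_norm_le)
    fix \<psi> assume "\<psi> \<in> X"
    show "norm (\<kappa> \<psi> * D \<psi>) \<le> 2 * \<epsilon>"
    proof (cases "\<psi> a = 1")
      case True
      then show ?thesis using \<kappa>(1)[OF \<open>\<psi> \<in> X\<close>] \<open>\<epsilon> > 0\<close> by simp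
    next
      case False
      then have "norm (D \<psi>) \<le> \<epsilon>" using close \<open>\<psi> \<in> X\<close> by (auto simp: D_def)
      then show ?thesis unfolding norm_mult using \<kappa>(2)[OF \<open>\<psi> \<in> X\<close>] by (intro mult_mono) auto
    qed
  qed
  finally show ?thesis by (simp add: mult.commute)
qed

text \<open>The coefficient of \<open>of_nat (n \<rho> \<psi>)\<close> is \<open>cnj (\<psi> a) - 1\<close> for the class \<open>a\<close>, and
\<open>cnj (\<psi> b) - 1 = \<psi> a - 1\<close> for its square \<open>b\<close>, since squaring inverts a cube root of unity.  So the
two differences follow the race sums of \<open>cnj (g \<rho>)\<close> and of \<open>g \<rho>\<close>, with opposite sign.\<close>

lemma P_differences_same_sign:
  assumes b: "\<And>\<psi>. \<psi> \<in> X \<Longrightarrow> \<psi> b = (\<psi> a)\<^sup>2"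
  obtains \<delta> where "\<delta> > 0"
    "\<And>T. \<exists>x\<ge>T. \<forall>c\<in>{a, b}. ln x / x powr \<beta> * (P_sys q B c x - P_sys q B 1 x) \<ge> \<delta>"
    "\<And>T. \<exists>x\<ge>T. \<forall>c\<in>{a, b}. ln x / x powr \<beta> * (P_sys q B c x - P_sys q B 1 x) \<le> - \<delta>"
proof -
  obtain A where A: "\<And>Z. finite Z \<Longrightarrow> Z \<subseteq> Z0 \<Longrightarrow> (\<Sum>\<rho>\<in>Z. norm (g \<rho>) / norm \<rho>) \<le> A"
    using race_sum_bound by blast
  have Z0: "Re \<rho> = \<beta>" "Re (g \<rho>) < 0" if "\<rho> \<in> Z0" for \<rho>
    using that Re_g_neg[of \<rho>] by (auto simp: z_sys_def)
  obtain \<rho>0 \<delta> where \<rho>0: "\<rho>0 \<in> Z0" "\<delta> > 0"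
    and osc: "\<And>Z T. finite Z \<Longrightarrow> \<rho>0 \<in> Z \<Longrightarrow> Z \<subseteq> Z0 \<Longrightarrow>
       (\<exists>u\<ge>T. race_sum g Z u \<ge> \<delta> \<and> race_sum (\<lambda>\<rho>. cnj (g \<rho>)) Z u \<ge> \<delta>) \<and>
       (\<exists>u\<ge>T. race_sum g Z u \<le> - \<delta> \<and> race_sum (\<lambda>\<rho>. cnj (g \<rho>)) Z u \<le> - \<delta>)"
    using race_sums_same_sign[OF beta_bounds(2,3) z_nonempty Z0(1) z_Im Z0(2) g_sector A] by blast
  (* small enough for the approximation error to use up at most half of \<delta> *)
  define \<epsilon> where "\<epsilon> = \<delta> / (4 * (real (card X) + 1))"
  have \<epsilon>: "\<epsilon> > 0" using \<rho>0 by (simp add: \<epsilon>_def)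
  have "2 * \<epsilon> * card X \<le> 2 * \<epsilon> * (card X + 1)" using \<epsilon> by simp
  also have "\<dots> = \<delta> / 2" by (simp add: \<epsilon>_def field_simps)
  finally have \<epsilon>X: "2 * \<epsilon> * card X \<le> \<delta> / 2" .
  obtain Z1 where Z1: "finite Z1" "Z1 \<subseteq> Z0"
    "\<And>Z. finite Z \<Longrightarrow> Z1 \<subseteq> Z \<Longrightarrow> Z \<subseteq> Z0 \<Longrightarrow> \<forall>\<^sub>F x in at_top. \<forall>\<psi>\<in>{\<psi>\<in>X. \<psi> a \<noteq> 1}.
       norm (of_real (ln x / x powr \<beta>) * zero_sum \<psi> x
             - (\<Sum>\<rho>\<in>Z. of_nat (n \<rho> \<psi>) / \<rho> * cis (Im \<rho> * ln x))) < \<epsilon>"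
    using zero_sum_approx_uniform[OF \<epsilon>] by blast
  define Z where "Z = insert \<rho>0 Z1"
  have Z: "finite Z" "\<rho>0 \<in> Z" "Z1 \<subseteq> Z" "Z \<subseteq> Z0" using Z1(1,2) \<rho>0 by (auto simp: Z_def)
  obtain T0 where T0: "\<And>x. x \<ge> T0 \<Longrightarrow> \<forall>\<psi>\<in>{\<psi>\<in>X. \<psi> a \<noteq> 1}.
       norm (of_real (ln x / x powr \<beta>) * zero_sum \<psi> x
             - (\<Sum>\<rho>\<in>Z. of_nat (n \<rho> \<psi>) / \<rho> * cis (Im \<rho> * ln x))) < \<epsilon>"
    using Z1(3)[OF Z(1,3,4)] unfolding eventually_at_top_linorder by blast
  have cnj_b: "cnj (\<psi> b) = \<psi> a" and nrm: "norm (\<psi> a) = 1"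
    if "\<psi> \<in> X" for \<psi>
    using cube_root_of_unity[OF char_cube[OF that]] b[OF that] by auto
  have ga: "(\<Sum>\<psi>\<in>X. of_nat (n \<rho> \<psi>) * (cnj (\<psi> a) - 1)) = cnj (g \<rho>)" for \<rho>
    by (simp add: g_eq)
  have gb: "(\<Sum>\<psi>\<in>X. of_nat (n \<rho> \<psi>) * (cnj (\<psi> b) - 1)) = g \<rho>" for \<rho>
    unfolding g_eq using cnj_b by (intro sum.cong) auto
  have norm2: "norm (cnj (\<psi> c) - 1) \<le> 2" if "\<psi> \<in> X" "c \<in> {a, b}" for \<psi> c
    using norm_triangle_ineq4[of "cnj (\<psi> c)" 1] nrm[OF that(1)] b[OF that(1)] that(2)
    by (auto simp: norm_power)
  have appr: "\<bar>ln x / x powr \<beta> * (P_sys q B c x - P_sys q B 1 x) +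
     2 / real (totient q) * race_sum (\<lambda>\<rho>. \<Sum>\<psi>\<in>X. of_nat (n \<rho> \<psi>) * (cnj (\<psi> c) - 1)) Z (ln x)\<bar>
     \<le> 2 / real (totient q) * (\<delta> / 2)" if "x \<ge> T0" "c \<in> {a, b}" for x c
  proof -
    have "\<psi> c = 1" if \<psi>: "\<psi> \<in> X" "\<psi> a = 1" for \<psi>
      using \<psi> \<open>c \<in> {a, b}\<close> b[OF \<psi>(1)] by auto
    then have "\<bar>ln x / x powr \<beta> * Re (\<Sum>\<psi>\<in>X. (cnj (\<psi> c) - 1) * zero_sum \<psi> x) -
          race_sum (\<lambda>\<rho>. \<Sum>\<psi>\<in>X. of_nat (n \<rho> \<psi>) * (cnj (\<psi> c) - 1)) Z (ln x)\<bar> \<le> 2 * \<epsilon> * card X"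
      using norm2 that T0 \<epsilon> by (intro combination_approx) auto
    then have "\<bar>- (2 / real (totient q)) * (ln x / x powr \<beta> * Re (\<Sum>\<psi>\<in>X. (cnj (\<psi> c) - 1) * zero_sum \<psi> x) -
          race_sum (\<lambda>\<rho>. \<Sum>\<psi>\<in>X. of_nat (n \<rho> \<psi>) * (cnj (\<psi> c) - 1)) Z (ln x))\<bar>
       \<le> 2 / real (totient q) * (\<delta> / 2)"
      unfolding abs_mult using \<epsilon>X by (intro mult_mono) auto
    moreover have "P_sys q B c x - P_sys q B 1 x =
        - (2 / real (totient q)) * Re (\<Sum>\<psi>\<in>X. (cnj (\<psi> c) - 1) * zero_sum \<psi> x)"
      unfolding zero_sum_def using char_one by (rule P_sys_diff)
    moreover have "l * (- k * S) + k * R = - k * (l * S - R)" for l k S R :: real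
      by (simp add: algebra_simps)
    ultimately show ?thesis by (simp only:)
  qed
  have tot: "totient q > 0" using q_pos by simp
  define \<delta>' where "\<delta>' = 2 / real (totient q) * (\<delta> / 2)"
  have pos: "2 / real (totient q) \<ge> 0" by simp
  show thesis
  proof (rule that[of \<delta>'])
    show "\<delta>' > 0" using tot \<rho>0 by (simp add: \<delta>'_def)
    have exp_ge: "exp u \<ge> T0" "exp u \<ge> T" if "u \<ge> max T0 T" for u T
      using that exp_ge_add_one_self[of u] by linarith+
    show "\<exists>x\<ge>T. \<forall>c\<in>{a, b}. ln x / x powr \<beta> * (P_sys q B c x - P_sys q B 1 x) \<ge> \<delta>'" for T
    proof -
      obtain u where u: "u \<ge> max T0 T" "race_sum g Z u \<le> - \<delta>" "race_sum (\<lambda>\<rho>. cnj (g \<rho>)) Z u \<le> - \<delta>"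
        using osc[OF Z(1,2,4)] by blast
      have "2 / real (totient q) * race_sum g Z u \<le> 2 / real (totient q) * - \<delta>"
        "2 / real (totient q) * race_sum (\<lambda>\<rho>. cnj (g \<rho>)) Z u \<le> 2 / real (totient q) * - \<delta>"
        by (rule mult_left_mono[OF u(2) pos], rule mult_left_mono[OF u(3) pos])
      then show ?thesis
        using appr[OF exp_ge(1)[OF u(1)], of a] appr[OF exp_ge(1)[OF u(1)], of b] exp_ge(2)[OF u(1)]
        unfolding ga gb ln_exp by (intro exI[of _ "exp u"]) (auto simp: \<delta>'_def)
    qed
    show "\<exists>x\<ge>T. \<forall>c\<in>{a, b}. ln x / x powr \<beta> * (P_sys q B c x - P_sys q B 1 x) \<le> - \<delta>'" for T
    proof -
      obtain u where u: "u \<ge> max T0 T" "race_sum g Z u \<ge> \<delta>" "race_sum (\<lambda>\<rho>. cnj (g \<rho>)) Z u \<ge> \<delta>"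
        using osc[OF Z(1,2,4)] by blast
      have "2 / real (totient q) * race_sum g Z u \<ge> 2 / real (totient q) * \<delta>"
        "2 / real (totient q) * race_sum (\<lambda>\<rho>. cnj (g \<rho>)) Z u \<ge> 2 / real (totient q) * \<delta>"
        by (rule mult_left_mono[OF u(2) pos], rule mult_left_mono[OF u(3) pos])
      then show ?thesis
        using appr[OF exp_ge(1)[OF u(1)], of a] appr[OF exp_ge(1)[OF u(1)], of b] exp_ge(2)[OF u(1)]
        unfolding ga gb ln_exp by (intro exI[of _ "exp u"]) (auto simp: \<delta>'_def)
    qed
  qed
qed

end

section \<open>Transfer to similar families\<close>

text \<open>Similarity is an error of \<open>o(x powr \<beta>' / ln x)\<close> with \<open>\<beta>' = R_minus q B\<close> in the application, which is
no worse than \<open>o(x powr \<beta> / ln x)\<close> for the abscissa \<open>\<beta> \<ge> \<beta>'\<close> that governs the oscillation.\<close>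

lemma beta_similar_differences_close:
  assumes "beta_similar q \<beta>' F P" "\<beta>' \<le> \<beta>" "\<delta> > 0"
    and "c \<in> carrier (reduced_residues q)" "d \<in> carrier (reduced_residues q)"
  shows "\<forall>\<^sub>F x in at_top.
     \<bar>ln x / x powr \<beta> * (F c x - F d x) - ln x / x powr \<beta> * (P c x - P d x)\<bar> < \<delta>"
proof -
  have *: "\<forall>\<^sub>F x in at_top. ln x / x powr \<beta> * \<bar>F e x - P e x\<bar> \<le> \<delta> / 3"
    if "e \<in> carrier (reduced_residues q)" for e
  proof -
    have "\<forall>\<^sub>F x in at_top. norm \<bar>F e x - P e x\<bar> \<le> \<delta> / 3 * norm (x powr \<beta>' / ln x)"
      using assms(1,3) that unfolding beta_similar_def by (intro landau_o.smallD) auto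
    then show ?thesis using eventually_gt_at_top[of 1]
    proof eventually_elim
      case (elim x)
      have "x powr \<beta>' / ln x \<le> x powr \<beta> / ln x"
        using elim assms(2) by (intro divide_right_mono powr_mono) auto
      then have "\<delta> / 3 * (x powr \<beta>' / ln x) \<le> \<delta> / 3 * (x powr \<beta> / ln x)"
        using assms(3) by (intro mult_left_mono) auto
      then have "\<bar>F e x - P e x\<bar> \<le> \<delta> / 3 * (x powr \<beta> / ln x)" using elim by simp
      then show ?case using elim by (simp add: field_simps)
    qed
  qed
  show ?thesis using *[OF assms(4)] *[OF assms(5)] eventually_gt_at_top[of 1]
  proof eventually_elim
    case (elim x)
    define L where "L = ln x / x powr \<beta>"
    have "L \<ge> 0" using elim by (simp add: L_def)
    then have "\<bar>L * (F c x - P c x)\<bar> \<le> \<delta> / 3" "\<bar>L * (F d x - P d x)\<bar> \<le> \<delta> / 3"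
      using elim by (auto simp: abs_mult L_def)
    then have "\<bar>L * (F c x - F d x) - L * (P c x - P d x)\<bar> < \<delta>"
      using assms(3) unfolding right_diff_distrib by linarith
    then show ?case by (simp add: L_def)
  qed
qed

theorem theorem3p4:
  fixes q :: nat and a :: int and G :: "int set" and B :: zero_system
  assumes "q \<ge> 3"
    and "a \<in> carrier (reduced_residues q)"
    and "G = {\<one>\<^bsub>reduced_residues q\<^esub>, a, a [^]\<^bsub>reduced_residues q\<^esub> (2::nat)}"
    and "subgroup G (reduced_residues q)"
    and "cyclic_group ((reduced_residues q)\<lparr>carrier := G\<rparr>)"
    and "card G = 3"
    and "is_system q B"
    and "z_sys q B a 1 \<noteq> {}"
    and "\<forall>\<rho>\<in>z_sys q B a 1. Im \<rho> \<ge> 2 + sqrt 3"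
  shows "barrier q B (\<lambda>F. \<forall>\<^sub>F x in at_top.
            F 1 x \<ge> min (F a x) (F (a [^]\<^bsub>reduced_residues q\<^esub> (2::nat)) x)) \<and>
         barrier q B (\<lambda>F. \<forall>\<^sub>F x in at_top.
            F 1 x \<le> max (F a x) (F (a [^]\<^bsub>reduced_residues q\<^esub> (2::nat)) x))"
proof -
  define b where "b = a [^]\<^bsub>reduced_residues q\<^esub> (2::nat)"
  have one: "\<one>\<^bsub>reduced_residues q\<^esub> = 1"
    by (simp add: reduced_residues_def units_of_def residue_ring_def)
  have G: "G \<subseteq> carrier (reduced_residues q)" using assms(4) by (rule subgroup.subset)
  have carrier: "1 \<in> carrier (reduced_residues q)" "b \<in> carrier (reduced_residues q)"
    using G unfolding assms(3) b_def one by auto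
  have char: "dirichlet_char q \<psi>" if "\<psi> \<in> nonprincipal_chars q" for \<psi>
    using that by (simp add: nonprincipal_chars_def)
  have "\<psi> a ^ 3 = 1" if "\<psi> \<in> nonprincipal_chars q" for \<psi>
    using cube_eq_one_in_subgroup[of q G a] dirichlet_char_pow[OF char[OF that], of a 3]
      dirichlet_char_one[OF char[OF that]] assms by simp
  then interpret cubic_race q B a
    using assms by unfold_locales (auto intro: dirichlet_char_one char)
  obtain \<delta> where \<delta>: "\<delta> > 0"
    and high: "\<And>T. \<exists>x\<ge>T. \<forall>c\<in>{a, b}. ln x / x powr \<beta> * (P_sys q B c x - P_sys q B 1 x) \<ge> \<delta>"
    and low: "\<And>T. \<exists>x\<ge>T. \<forall>c\<in>{a, b}. ln x / x powr \<beta> * (P_sys q B c x - P_sys q B 1 x) \<le> - \<delta>"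
    using P_differences_same_sign[of b] dirichlet_char_pow char unfolding b_def by metis
  have close: "\<forall>\<^sub>F x in at_top. \<forall>c\<in>{a, b}.
      \<bar>ln x / x powr \<beta> * (F c x - F 1 x) - ln x / x powr \<beta> * (P_sys q B c x - P_sys q B 1 x)\<bar> < \<delta>"
    if "beta_similar q (R_minus q B) F (P_sys q B)" for F
    using beta_similar_differences_close[OF that beta_bounds(1) \<delta>] assms(2) carrier
    by (intro eventually_ball_finite) auto
  have "\<not> (\<forall>\<^sub>F x in at_top. F 1 x \<ge> min (F a x) (F b x))"
    and "\<not> (\<forall>\<^sub>F x in at_top. F 1 x \<le> max (F a x) (F b x))"
    if sim: "beta_similar q (R_minus q B) F (P_sys q B)" for F
  proof -
    obtain T where T: "T > 1" and near: "\<And>x c. x \<ge> T \<Longrightarrow> c \<in> {a, b} \<Longrightarrow>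
      \<bar>ln x / x powr \<beta> * (F c x - F 1 x) - ln x / x powr \<beta> * (P_sys q B c x - P_sys q B 1 x)\<bar> < \<delta>"
      using eventually_conj[OF close[OF sim] eventually_gt_at_top[of 1]]
      unfolding eventually_at_top_linorder by (metis order_refl)
    have L: "ln x / x powr \<beta> > 0" if "x \<ge> T" for x using T that by simp
    have above: "\<exists>x\<ge>S. F a x > F 1 x \<and> F b x > F 1 x" for S
    proof -
      obtain x where x: "x \<ge> max S T"
        "\<And>c. c \<in> {a, b} \<Longrightarrow> ln x / x powr \<beta> * (P_sys q B c x - P_sys q B 1 x) \<ge> \<delta>"
        using high by blast
      have "F c x > F 1 x" if "c \<in> {a, b}" for c
      proof -
        have "ln x / x powr \<beta> * (F c x - F 1 x) > 0"
          using near[of x c] x(1) x(2)[OF that] that by linarith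
        then have "F c x - F 1 x > 0" by (rule zero_less_mult_pos) (rule L, use x(1) in simp)
        then show ?thesis by simp
      qed
      then show ?thesis using x(1) by auto
    qed
    have below: "\<exists>x\<ge>S. F a x < F 1 x \<and> F b x < F 1 x" for S
    proof -
      obtain x where x: "x \<ge> max S T"
        "\<And>c. c \<in> {a, b} \<Longrightarrow> ln x / x powr \<beta> * (P_sys q B c x - P_sys q B 1 x) \<le> - \<delta>"
        using low by blast
      have "F c x < F 1 x" if "c \<in> {a, b}" for c
      proof -
        have "ln x / x powr \<beta> * (F c x - F 1 x) < 0"
          using near[of x c] x(1) x(2)[OF that] that by linarith
        then have "0 < ln x / x powr \<beta> * (F 1 x - F c x)" unfolding right_diff_distrib by linarith
        then have "F 1 x - F c x > 0" by (rule zero_less_mult_pos) (rule L, use x(1) in simp)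
        then show ?thesis by simp
      qed
      then show ?thesis using x(1) by auto
    qed
    show "\<not> (\<forall>\<^sub>F x in at_top. F 1 x \<ge> min (F a x) (F b x))"
      using above unfolding eventually_at_top_linorder by (meson min_less_iff_conj not_le)
    show "\<not> (\<forall>\<^sub>F x in at_top. F 1 x \<le> max (F a x) (F b x))"
      using below unfolding eventually_at_top_linorder by (meson max_less_iff_conj not_le)
  qed
  then show ?thesis unfolding barrier_def b_def by blast
qed

end
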